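(* Let $S$ be any mixed subdivision of $n\Delta_{d-1}$ (not necessarily fine). Then the set of types of the cells of $S$ satisfies the elimination property: for any two cell types $A,B$ of $S$ and any $j\in[n]$ there is a cell type $C$ of $S$ with $C_j=A_j\cup B_j$ and $C_k\in\{A_k,B_k,A_k\cup B_k\}$ for all $k\in[n]$.
   Context: Let $\Delta_{d-1}=\mathrm{conv}\{e_1,\dots,e_d\}\subset\mathbb R^d$ and $\Delta_J=\mathrm{conv}\{e_j:j\in J\}$ for nonempty $J\subseteq[d]$. A mixed subdivision of $n\Delta_{d-1}$ is a polyhedral subdivision of $n\Delta_{d-1}$ into cells, each given together with a Minkowski decomposition $\Delta_{A_1}+\dots+\Delta_{A_n}$ with $\emptyset\ne A_i\subseteq[d]$; the $n$-tuple $(A_1,\dots,A_n)$ is the type of the cell. It is required that for any two cells of types $A,B$ their intersection equals $\sum_i(\Delta_{A_i}\cap\Delta_{B_i})$. It is fine if no other mixed subdivision refines it. *)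

theory Defs
  imports "HOL-Analysis.Analysis"
begin

definition coord_simplex :: "'d::finite set \<Rightarrow> (real^'d) set" where
  "coord_simplex J = convex hull ((\<lambda>j. axis j 1) ` J)"

text \<open>The sum over sets is the Minkowski sum; it is empty as soon as one summand is empty.\<close>

definition minkowski_cell :: "('n::finite \<Rightarrow> 'd::finite set) \<Rightarrow> (real^'d) set" where
  "minkowski_cell A = (\<Sum>i\<in>UNIV. coord_simplex (A i))"

text \<open>The cells of a subdivision have all dimensions: every nonempty face of a cell is itself
  a cell. The empty set is not a cell, although two cells may meet in the empty face.\<close>

definition polyhedral_subdivision :: "'a::euclidean_space set \<Rightarrow> 'a set set \<Rightarrow> bool" where
  "polyhedral_subdivision P K \<longleftrightarrow>
     finite K \<and>
     (\<forall>C\<in>K. polytope C \<and> C \<noteq> {}) \<and>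
     (\<forall>C\<in>K. \<forall>F. F face_of C \<and> F \<noteq> {} \<longrightarrow> F \<in> K) \<and>
     (\<forall>C\<in>K. \<forall>D\<in>K. C \<inter> D face_of C \<and> C \<inter> D face_of D) \<and>
     \<Union>K = P"

text \<open>Here \<open>K\<close> is the set of cells and \<open>\<tau> C\<close> is the type of the cell \<open>C\<close>, i.e. the Minkowski
  decomposition that \<open>C\<close> is given with. The number of summands is \<open>CARD('n)\<close>, and the simplex
  being dilated is spanned by the \<open>CARD('d)\<close> unit vectors.\<close>

definition mixed_subdivision ::
  "(real^'d::finite) set set \<Rightarrow> ((real^'d) set \<Rightarrow> 'n::finite \<Rightarrow> 'd set) \<Rightarrow> bool" where
  "mixed_subdivision K \<tau> \<longleftrightarrow>
     polyhedral_subdivision ((\<lambda>x. real CARD('n) *\<^sub>R x) ` coord_simplex UNIV) K \<and>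
     (\<forall>C\<in>K. (\<forall>i. \<tau> C i \<noteq> {}) \<and> C = minkowski_cell (\<tau> C)) \<and>
     (\<forall>C\<in>K. \<forall>D\<in>K. C \<inter> D = (\<Sum>i\<in>UNIV. coord_simplex (\<tau> C i) \<inter> coord_simplex (\<tau> D i)))"

definition cell_types :: "'c set \<Rightarrow> ('c \<Rightarrow> 'n \<Rightarrow> 'd set) \<Rightarrow> ('n \<Rightarrow> 'd set) set" where
  "cell_types K \<tau> = \<tau> ` K"

definition elimination_property :: "('n \<Rightarrow> 'd set) set \<Rightarrow> bool" where
  "elimination_property T \<longleftrightarrow>
     (\<forall>A\<in>T. \<forall>B\<in>T. \<forall>j. \<exists>C\<in>T. C j = A j \<union> B j \<and> (\<forall>k. C k \<in> {A k, B k, A k \<union> B k}))"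

end

theory Submission
  imports Defs
begin

text \<open>
  Via the Cayley trick, a cell of type \<open>D\<close> becomes the cone of pairs (row sums, column sums) of the
  nonnegative matrices supported on \<open>D\<close>; the original subdivision is the slice of these cones in
  which all row sums are 1. Cones in other slices still meet properly: along a straight line that
  starts in the slice, a first improper intersection contradicts the local covering property. Hence
  any two types \<open>A\<close>, \<open>C\<close> are separated by a pair of row and column potentials that is strict off
  \<open>A \<inter> C\<close>; these replace the difference of two points in a tropical hyperplane arrangement.

  Given \<open>A\<close>, \<open>B\<close> and \<open>j\<close>, normalise all potentials to vanish in row \<open>j\<close>. Brouwer's theorem gives a
  matrix in a cell \<open>C\<close> that is in equilibrium with the potentials separating \<open>C\<close> from \<open>A\<close> and from
  \<open>B\<close>. The maximum of the two potentials plays the role of the point on the tropical segment from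
  \<open>A\<close> to \<open>B\<close> lying on the \<open>j\<close>-th hyperplane, and the face of \<open>C\<close> maximising it has the type
  required.
\<close>

subsection \<open>Cayley cones\<close>

definition nonneg_on :: "('n::finite \<Rightarrow> 'd::finite set) \<Rightarrow> (real^'d^'n) set" where
  "nonneg_on D = {M. \<forall>k j. 0 \<le> M $ k $ j \<and> (M $ k $ j \<noteq> 0 \<longrightarrow> j \<in> D k)}"

definition margins :: "real^'d::finite^'n::finite \<Rightarrow> (real^'n) \<times> (real^'d)" where
  "margins M = ((\<chi> k. \<Sum>j\<in>UNIV. M $ k $ j), (\<chi> j. \<Sum>k\<in>UNIV. M $ k $ j))"

text \<open>The cone generated by the pairs of unit vectors with indices \<open>k\<close> and
  \<open>j\<close>, where \<open>j \<in> D k\<close>: the edges of the bipartite graph of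
  \<open>D\<close>. Its slice with all row sums 1 is a copy of the mixed cell of type
  \<open>D\<close>.\<close>

definition cayley_cone :: "('n::finite \<Rightarrow> 'd::finite set) \<Rightarrow> ((real^'n) \<times> (real^'d)) set" where
  "cayley_cone D = margins ` nonneg_on D"

definition uniform_on :: "('n::finite \<Rightarrow> 'd::finite set) \<Rightarrow> real^'d^'n" where
  "uniform_on D = (\<chi> k j. if j \<in> D k then 1 / real (card (D k)) else 0)"

definition normalise_rows :: "real^'d::finite^'n::finite \<Rightarrow> real^'d^'n" where
  "normalise_rows M = (\<chi> k j. M $ k $ j / fst (margins M) $ k)"

lemma linear_margins: "linear margins"
  by (rule linearI) (simp_all add: margins_def vec_eq_iff sum.distrib sum_distrib_left)

lemmas margins_linear_simps = linear_add[OF linear_margins] linear_diff[OF linear_margins]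
  linear_scale[OF linear_margins] linear_0[OF linear_margins]

lemma fst_margins: "fst (margins M) $ k = (\<Sum>j\<in>UNIV. M $ k $ j)"
  and snd_margins: "snd (margins M) $ j = (\<Sum>k\<in>UNIV. M $ k $ j)"
  by (simp_all add: margins_def)

lemma nonneg_onI:
  "(\<And>k j. 0 \<le> M $ k $ j) \<Longrightarrow> (\<And>k j. j \<notin> D k \<Longrightarrow> M $ k $ j = 0) \<Longrightarrow> M \<in> nonneg_on D"
  by (auto simp: nonneg_on_def)

lemma nonneg_onD: "M \<in> nonneg_on D \<Longrightarrow> 0 \<le> M $ k $ j"
  "M \<in> nonneg_on D \<Longrightarrow> M $ k $ j \<noteq> 0 \<Longrightarrow> j \<in> D k"
  "M \<in> nonneg_on D \<Longrightarrow> j \<notin> D k \<Longrightarrow> M $ k $ j = 0"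
  by (auto simp: nonneg_on_def)

lemma nonneg_on_mono: "M \<in> nonneg_on D \<Longrightarrow> D \<le> D' \<Longrightarrow> M \<in> nonneg_on D'"
  by (auto simp: nonneg_on_def le_fun_def)

lemma nonneg_on_Int: "M \<in> nonneg_on C \<Longrightarrow> M \<in> nonneg_on D \<Longrightarrow> M \<in> nonneg_on (\<lambda>k. C k \<inter> D k)"
  by (auto simp: nonneg_on_def)

lemma nonneg_on_top: "M \<in> nonneg_on D \<Longrightarrow> M \<in> nonneg_on (\<lambda>_. UNIV)"
  by (auto simp: nonneg_on_def)

lemma nonneg_on_add: "M \<in> nonneg_on D \<Longrightarrow> N \<in> nonneg_on D \<Longrightarrow> M + N \<in> nonneg_on D"
  unfolding nonneg_on_def by (intro CollectI allI conjI impI; simp; metis add_0)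

lemma nonneg_on_scale: "M \<in> nonneg_on D \<Longrightarrow> 0 \<le> c \<Longrightarrow> c *\<^sub>R M \<in> nonneg_on D"
  by (auto simp: nonneg_on_def)

lemma nonneg_on_addD1:
  assumes "M + N \<in> nonneg_on D" "M \<in> nonneg_on C" "N \<in> nonneg_on C"
  shows "M \<in> nonneg_on D"
  unfolding nonneg_on_def
proof (intro CollectI allI conjI impI)
  fix k j show "0 \<le> M $ k $ j" using assms(2) by (rule nonneg_onD)
  assume "M $ k $ j \<noteq> 0"
  moreover have "0 \<le> N $ k $ j" "0 \<le> M $ k $ j" using assms(2,3) by (auto dest: nonneg_onD(1))
  ultimately have "(M + N) $ k $ j \<noteq> 0" by simp
  thus "j \<in> D k" by (rule nonneg_onD(2)[OF assms(1)])
qed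

text \<open>Used to turn support statements into inclusions of types, with \<open>N\<close>
  representing a relative interior point of the cone of \<open>E\<close>.\<close>

lemma full_support_le:
  "N \<in> nonneg_on D \<Longrightarrow> (\<And>k j. j \<in> E k \<Longrightarrow> 0 < N $ k $ j) \<Longrightarrow> E \<le> D"
  by (metis le_funI less_irrefl nonneg_onD(3) subsetI)

lemma fst_margins_pos:
  assumes "M \<in> nonneg_on D" "0 < M $ k $ j"
  shows "0 < fst (margins M) $ k"
  unfolding fst_margins using assms nonneg_onD(1)[OF assms(1)]
  by (intro sum_pos2[of UNIV j]) auto

lemma normalise_rows_nonneg: "M \<in> nonneg_on D \<Longrightarrow> normalise_rows M \<in> nonneg_on D"
  by (auto simp: nonneg_on_def normalise_rows_def fst_margins intro!: divide_nonneg_nonneg sum_nonneg)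

lemma normalise_rows_margins:
  assumes "\<And>k. fst (margins M) $ k > 0"
  shows "fst (margins (normalise_rows M)) $ k = 1"
  unfolding fst_margins[of "normalise_rows M"] using assms[of k]
  by (simp add: normalise_rows_def flip: sum_divide_distrib fst_margins)

lemma normalise_rows_pos:
  assumes "fst (margins M) $ k > 0" "M $ k $ j > 0"
  shows "normalise_rows M $ k $ j > 0"
  using assms by (simp add: normalise_rows_def)

lemma uniform_on_props:
  assumes "\<And>k. D k \<noteq> {}"
  shows "uniform_on D \<in> nonneg_on D" "fst (margins (uniform_on D)) $ k = 1"
    "j \<in> D k \<Longrightarrow> uniform_on D $ k $ j > 0"
  using assms by (auto simp: nonneg_on_def uniform_on_def fst_margins card_gt_0_iff sum.If_cases)

lemma total_margins: "(\<Sum>k\<in>UNIV. fst (margins M) $ k) = (\<Sum>j\<in>UNIV. snd (margins M) $ j)"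
  unfolding fst_margins snd_margins by (rule sum.swap)

lemma convex_cayley_cone: "convex (cayley_cone D)"
  unfolding cayley_cone_def
  by (intro convex_linear_image linear_margins) (auto simp: convex_def nonneg_on_add nonneg_on_scale)

lemma cayley_coneI: "M \<in> nonneg_on D \<Longrightarrow> margins M \<in> cayley_cone D"
  by (simp add: cayley_cone_def)

lemma cayley_coneE:
  assumes "x \<in> cayley_cone D"
  obtains M where "M \<in> nonneg_on D" "margins M = x"
  using assms by (auto simp: cayley_cone_def)

section \<open>Closedness of the Cayley cones\<close>

lemma closed_nonneg_on: "closed (nonneg_on D)"
proof -
  have "nonneg_on D = (\<Inter>k. \<Inter>j. {M. 0 \<le> M $ k $ j}) \<inter> (\<Inter>k. \<Inter>j\<in>-D k. {M. M $ k $ j = 0})"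
    by (auto simp: nonneg_on_def)
  moreover have "closed \<dots>"
    by (intro closed_Int closed_INT ballI closed_Collect_le closed_Collect_eq continuous_intros)
  ultimately show ?thesis by simp
qed

lemma continuous_on_margins: "continuous_on A margins"
  by (rule linear_continuous_on) (simp add: linear_conv_bounded_linear[symmetric] linear_margins)

text \<open>Each entry is at most its row sum. The bound keeps matrices over a convergent sequence
  of margins bounded, which makes the Cayley cones closed.\<close>

lemma norm_le_norm_margins:
  fixes M :: "real^'d::finite^'n::finite"
  assumes M: "M \<in> nonneg_on D"
  shows "norm M \<le> real CARD('n) * (real CARD('d) * norm (margins M))"
  proof -
    have "\<bar>M $ k $ j\<bar> \<le> norm (margins M)" for k j
    proof -
      have "M $ k $ j \<le> fst (margins M) $ k"
        unfolding fst_margins using M by (intro member_le_sum) (auto simp: nonneg_on_def)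
      also have "\<dots> \<le> norm (fst (margins M))" using component_le_norm_cart[of "fst (margins M)" k] by linarith
      also have "\<dots> \<le> norm (margins M)" by (metis norm_fst_le prod.collapse)
      finally show ?thesis using nonneg_onD(1)[OF M, of k j] by simp
    qed
    hence "norm (M $ k) \<le> (\<Sum>j::'d\<in>UNIV. norm (margins M))" for k
      using norm_le_l1_cart[of "M $ k"] sum_mono[of UNIV "\<lambda>j. \<bar>M $ k $ j\<bar>" "\<lambda>_. norm (margins M)"]
      by (meson order_trans)
    hence "norm (M $ k) \<le> real CARD('d) * norm (margins M)" for k by simp
    hence "(\<Sum>k\<in>UNIV. norm (M $ k)) \<le> (\<Sum>k::'n\<in>UNIV. real CARD('d) * norm (margins M))"
      by (intro sum_mono) auto
    moreover have "norm M \<le> (\<Sum>k\<in>UNIV. norm (M $ k))"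
      unfolding norm_vec_def by (rule L2_set_le_sum) auto
    ultimately show ?thesis by simp
  qed

lemma closed_cayley_cone:
  fixes D :: "'n::finite \<Rightarrow> 'd::finite set"
  shows "closed (cayley_cone D)"
proof -
  show ?thesis
    unfolding closed_sequential_limits
  proof (intro allI impI, elim conjE)
    fix x l assume x: "\<forall>n. x n \<in> cayley_cone D" and l: "x \<longlonglongrightarrow> l"
    have "\<exists>M. M \<in> nonneg_on D \<and> x n = margins M" for n
      using x by (auto simp: cayley_cone_def)
    then obtain M where M: "\<And>n. M n \<in> nonneg_on D" "\<And>n. x n = margins (M n)"
      by metis
    obtain B where B: "\<And>n. norm (x n) \<le> B"
      using convergent_imp_bounded[OF l] by (auto simp: bounded_iff)
    have "bounded (range M)"
      unfolding bounded_iff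
    proof (intro exI ballI)
      fix y assume "y \<in> range M"
      then obtain n where y: "y = M n" by blast
      have "norm y \<le> real CARD('n) * (real CARD('d) * norm (x n))" using norm_le_norm_margins[OF M(1)] M(2) y by simp
      also have "\<dots> \<le> real CARD('n) * (real CARD('d) * B)" by (intro mult_left_mono B) auto
      finally show "norm y \<le> real CARD('n) * (real CARD('d) * B)" .
    qed
    then obtain M' r where r: "strict_mono (r :: nat \<Rightarrow> nat)" "(M \<circ> r) \<longlonglongrightarrow> M'"
      using bounded_imp_convergent_subsequence by blast
    have "M' \<in> nonneg_on D"
      by (rule closed_sequentially[OF closed_nonneg_on _ r(2)]) (simp add: M(1))
    moreover have "(\<lambda>n. margins (M (r n))) \<longlonglongrightarrow> margins M'"
      using continuous_on_tendsto_compose[OF continuous_on_margins[of UNIV] r(2)] by (simp add: o_def)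
    hence "(x \<circ> r) \<longlonglongrightarrow> margins M'" by (simp add: M(2) o_def)
    hence "l = margins M'" using LIMSEQ_subseq_LIMSEQ[OF l r(1)] LIMSEQ_unique by blast
    ultimately show "l \<in> cayley_cone D" by (simp add: cayley_coneI)
  qed
qed

section \<open>The polytope of row-stochastic matrices\<close>

definition row_stochastic_on :: "('n::finite \<Rightarrow> 'd::finite set) \<Rightarrow> (real^'d^'n) set" where
  "row_stochastic_on D = {M \<in> nonneg_on D. \<forall>k. fst (margins M) $ k = 1}"

lemma convex_row_stochastic_on: "convex (row_stochastic_on D)"
  unfolding row_stochastic_on_def convex_def
  by (auto simp: nonneg_on_add nonneg_on_scale margins_linear_simps)

lemma compact_row_stochastic_on:
  fixes D :: "'n::finite \<Rightarrow> 'd::finite set"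
  shows "compact (row_stochastic_on D)"
  unfolding compact_eq_bounded_closed
proof
  show "bounded (row_stochastic_on D)"
    unfolding bounded_iff
  proof (intro exI ballI)
    fix M assume "M \<in> row_stochastic_on D"
    hence M: "M \<in> nonneg_on D" "\<And>k. fst (margins M) $ k = 1" by (auto simp: row_stochastic_on_def)
    have "norm (M $ k) \<le> 1" for k
    proof -
      have "norm (M $ k) \<le> (\<Sum>j\<in>UNIV. \<bar>M $ k $ j\<bar>)" by (rule norm_le_l1_cart)
      also have "\<dots> = fst (margins M) $ k"
        unfolding fst_margins using nonneg_onD(1)[OF M(1)] by simp
      finally show ?thesis by (simp add: M(2))
    qed
    hence "(\<Sum>k\<in>UNIV. norm (M $ k)) \<le> (\<Sum>k::'n\<in>UNIV. 1)" by (intro sum_mono)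
    moreover have "norm M \<le> (\<Sum>k\<in>UNIV. norm (M $ k))"
      unfolding norm_vec_def by (rule L2_set_le_sum) auto
    ultimately show "norm M \<le> real CARD('n)" by simp
  qed
  have "row_stochastic_on D = nonneg_on D \<inter> (\<Inter>k. {M. (\<Sum>j\<in>UNIV. M $ k $ j) = 1})"
    by (auto simp: row_stochastic_on_def fst_margins)
  moreover have "closed \<dots>"
    by (intro closed_Int closed_nonneg_on closed_INT ballI closed_Collect_eq continuous_intros)
  ultimately show "closed (row_stochastic_on D)" by simp
qed

subsection \<open>The Cayley trick\<close>

text \<open>On \<open>E\<close>, positivity survives a small step in any direction; off
  \<open>E\<close>, both matrices are nonnegative. There are finitely many entries, so one
  \<open>e\<close> serves all.\<close>

lemma perturb_nonneg:
  fixes Z W :: "real^'d::finite^'n::finite"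
  assumes E: "\<And>k j. j \<in> E k \<Longrightarrow> 0 < Z $ k $ j"
    and outside: "\<And>k j. j \<notin> E k \<Longrightarrow> 0 \<le> Z $ k $ j" "\<And>k j. j \<notin> E k \<Longrightarrow> 0 \<le> W $ k $ j"
  obtains e where "0 < e" "e \<le> 1" "\<And>k j. 0 \<le> (Z + e *\<^sub>R W) $ k $ j"
    "\<And>k j. j \<in> E k \<Longrightarrow> 0 < (Z + e *\<^sub>R W) $ k $ j"
proof -
  have "\<forall>\<^sub>F e in at_right 0. j \<in> E k \<longrightarrow> 0 < (Z + e *\<^sub>R W) $ k $ j" for k j
  proof (cases "j \<in> E k")
    case True
    have "((\<lambda>e. (Z + e *\<^sub>R W) $ k $ j) \<longlongrightarrow> (Z + 0 *\<^sub>R W) $ k $ j) (at_right 0)"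
      by (intro tendsto_intros)
    from order_tendstoD(1)[OF this, of 0] E[OF True] show ?thesis by (auto elim: eventually_mono)
  qed simp
  hence "\<forall>\<^sub>F e in at_right 0. \<forall>k j. j \<in> E k \<longrightarrow> 0 < (Z + e *\<^sub>R W) $ k $ j"
    by (intro eventually_all_finite)
  moreover have "\<forall>\<^sub>F e in at_right (0::real). 0 < e \<and> e \<le> 1"
    by (auto simp: eventually_at_right_field intro: exI[of _ 1])
  ultimately have "\<forall>\<^sub>F e in at_right 0. (0 < e \<and> e \<le> 1) \<and> (\<forall>k j. j \<in> E k \<longrightarrow> 0 < (Z + e *\<^sub>R W) $ k $ j)"
    by (simp add: eventually_conj_iff)
  from eventually_happens'[OF trivial_limit_at_right_real this]
  obtain e where e: "0 < e" "e \<le> 1" "\<And>k j. j \<in> E k \<Longrightarrow> 0 < (Z + e *\<^sub>R W) $ k $ j" by auto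
  have "0 \<le> (Z + e *\<^sub>R W) $ k $ j" for k j
    using e(1) e(3)[of j k] outside[of j k] by (cases "j \<in> E k") auto
  thus thesis using that e by blast
qed

text \<open>Everything that elimination uses of a mixed subdivision, in terms of matrices.
  \<open>unit_compat\<close> encodes that cells meet in common faces, \<open>unit_cover\<close> that
  their relative interiors cover. Both concern only row sums 1, the slice in which the subdivision
  lives.\<close>

locale type_complex =
  fixes T :: "('n::finite \<Rightarrow> 'd::finite set) set"
  assumes finite_types: "finite T"
    and nonempty: "C \<in> T \<Longrightarrow> C k \<noteq> {}"
    and argmax_face: "C \<in> T \<Longrightarrow> (\<lambda>k. {j \<in> C k. \<forall>l\<in>C k. w l \<le> (w j :: real)}) \<in> T"
    and inter: "C \<in> T \<Longrightarrow> D \<in> T \<Longrightarrow> (\<And>k. C k \<inter> D k \<noteq> {}) \<Longrightarrow> (\<lambda>k. C k \<inter> D k) \<in> T"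
    and unit_compat: "C \<in> T \<Longrightarrow> D \<in> T \<Longrightarrow> M \<in> nonneg_on C \<Longrightarrow> N \<in> nonneg_on D \<Longrightarrow>
      (\<And>k. fst (margins M) $ k = 1) \<Longrightarrow> margins M = margins N \<Longrightarrow> M \<in> nonneg_on D"
    and unit_cover: "M \<in> nonneg_on (\<lambda>_. UNIV) \<Longrightarrow> (\<And>k. fst (margins M) $ k = 1) \<Longrightarrow>
      \<exists>E\<in>T. \<exists>N\<in>nonneg_on E. margins N = margins M \<and> (\<forall>k. \<forall>j\<in>E k. 0 < N $ k $ j)"
begin

text \<open>\<open>M - N\<close> has zero margins and is nonnegative off \<open>E\<close>, so a
  small multiple can be added to the uniform matrix on \<open>E\<close>, whose row sums are 1. There
  \<open>unit_compat\<close> forces the sum, and with it \<open>M\<close>, to vanish off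
  \<open>E\<close>.\<close>

lemma face_support:
  assumes T: "E \<in> T" "D \<in> T" "E \<le> D" and M: "M \<in> nonneg_on D" and N: "N \<in> nonneg_on E"
    and eq: "margins M = margins N"
  shows "M \<in> nonneg_on E"
proof -
  define u where "u = uniform_on E"
  note u = uniform_on_props[of E, OF nonempty[OF T(1)], folded u_def]
  have out: "(M - N) $ k $ j = M $ k $ j" "u $ k $ j = 0" if "j \<notin> E k" for k j
    using nonneg_onD(3)[OF N that] nonneg_onD(3)[OF u(1) that] by auto
  obtain e where e: "0 < e" "e \<le> 1" "\<And>k j. 0 \<le> (u + e *\<^sub>R (M - N)) $ k $ j"
    by (rule perturb_nonneg[of E u "M - N"])
      (use u(3) out nonneg_onD(1)[OF u(1)] nonneg_onD(1)[OF M] in auto)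
  have "u + e *\<^sub>R (M - N) \<in> nonneg_on D"
  proof (rule nonneg_onI[OF e(3)])
    fix k j assume j: "j \<notin> D k"
    hence "j \<notin> E k" using T(3) by (auto simp: le_fun_def)
    with j out[of j k] nonneg_onD(3)[OF M j] show "(u + e *\<^sub>R (M - N)) $ k $ j = 0" by simp
  qed
  moreover have "margins (u + e *\<^sub>R (M - N)) = margins u"
    by (simp add: margins_linear_simps eq)
  ultimately have *: "u + e *\<^sub>R (M - N) \<in> nonneg_on E"
    using unit_compat[OF T(2,1) _ u(1)] u(2) by simp
  have "M $ k $ j = 0" if "j \<notin> E k" for k j
    using out[OF that] nonneg_onD(3)[OF * that] e(1) by simp
  thus ?thesis using M by (auto simp: nonneg_on_def)
qed

text \<open>\<open>E\<close> is the type whose relatively open cone contains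
  \<open>margins M\<close>. It is found in the slice of row sums 1 after dividing each row by its
  sum; adding a small multiple of \<open>N0 - u\<close>, which has zero margins, carries full
  support back to the original margins.\<close>

lemma carrier:
  assumes D: "D \<in> T" and M: "M \<in> nonneg_on D" and pos: "\<And>k. 0 < fst (margins M) $ k"
  obtains E N where "E \<in> T" "E \<le> D" "N \<in> nonneg_on E" "\<And>k j. j \<in> E k \<Longrightarrow> 0 < N $ k $ j"
    "margins N = margins M" "M \<in> nonneg_on E"
proof -
  define u where "u = normalise_rows M"
  have u: "u \<in> nonneg_on D" "\<And>k. fst (margins u) $ k = 1"
    unfolding u_def by (rule normalise_rows_nonneg[OF M], rule normalise_rows_margins[OF pos])
  obtain E N0 where E: "E \<in> T" "N0 \<in> nonneg_on E" "margins N0 = margins u"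
      "\<And>k j. j \<in> E k \<Longrightarrow> 0 < N0 $ k $ j"
    using unit_cover[OF nonneg_on_top[OF u(1)] u(2)] by blast
  have "N0 \<in> nonneg_on D" using unit_compat[OF E(1) D E(2) u(1)] u(2) E(3) by simp
  hence ED: "E \<le> D" using full_support_le E(4) by blast
  have uE: "u \<in> nonneg_on E" by (rule unit_compat[OF D E(1) u(1) E(2) u(2) E(3)[symmetric]])
  have u0: "u $ k $ j = 0 \<longleftrightarrow> M $ k $ j = 0" for k j
    using pos[of k] by (simp add: u_def normalise_rows_def)
  have ME: "M \<in> nonneg_on E" using M uE u0 by (auto simp: nonneg_on_def)
  have M0: "M $ k $ j = 0" if "\<not> 0 < M $ k $ j" for k j
    using nonneg_onD(1)[OF M, of k j] that by simp
  have out: "0 \<le> (N0 - u) $ k $ j" if "\<not> 0 < M $ k $ j" for k j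
    using M0[OF that] u0[of k j] nonneg_onD(1)[OF E(2), of k j] by simp
  obtain e where e: "0 < e" "e \<le> 1" "\<And>k j. 0 \<le> (M + e *\<^sub>R (N0 - u)) $ k $ j"
    "\<And>k j. j \<in> {j. 0 < M $ k $ j} \<Longrightarrow> 0 < (M + e *\<^sub>R (N0 - u)) $ k $ j"
    by (rule perturb_nonneg[of "\<lambda>k. {j. 0 < M $ k $ j}" M "N0 - u"])
      (use out nonneg_onD(1)[OF M] in auto)
  define N where "N = M + e *\<^sub>R (N0 - u)"
  have "N $ k $ j > 0" if "j \<in> E k" for k j
  proof (cases "M $ k $ j > 0")
    case True thus ?thesis using e(4) by (simp add: N_def)
  next
    case False
    hence "M $ k $ j = 0" "u $ k $ j = 0" using M0 u0 by auto
    thus ?thesis using E(4)[OF that] e(1) by (simp add: N_def)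
  qed
  moreover have "N \<in> nonneg_on E"
    unfolding N_def using nonneg_onD(3)[OF ME] nonneg_onD(3)[OF uE] nonneg_onD(3)[OF E(2)]
    by (intro nonneg_onI e(3)) simp
  moreover have "margins N = margins M" by (simp add: N_def margins_linear_simps E(3))
  ultimately show thesis using that E(1) ED ME by blast
qed

text \<open>The cones that miss \<open>P\<close> are finitely many closed sets, so they keep a
  positive distance from it.\<close>

lemma nearby_cones:
  obtains e where "0 < e" "\<And>D x. D \<in> T \<Longrightarrow> x \<in> cayley_cone D \<Longrightarrow> dist P x < e \<Longrightarrow> P \<in> cayley_cone D"
proof -
  define F where "F = (\<Union>D\<in>{D\<in>T. P \<notin> cayley_cone D}. cayley_cone D)"
  have "closed F" unfolding F_def using finite_types by (intro closed_UN) (auto simp: closed_cayley_cone)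
  moreover have "P \<notin> F" by (auto simp: F_def)
  ultimately obtain e where "e > 0" "ball P e \<subseteq> - F"
    using open_contains_ball[of "- F"] by (auto simp: open_Compl)
  thus thesis using that[of e] unfolding F_def by (fastforce simp: subset_iff)
qed

text \<open>\<open>unit_cover\<close> supplies a cone at the point with parameter \<open>e\<close>;
  for small \<open>e\<close> this point is so near to \<open>margins M0\<close> that the same cone
  contains the start.\<close>

lemma unit_local_cover:
  assumes M0: "M0 \<in> nonneg_on (\<lambda>_. UNIV)" "\<And>k. fst (margins M0) $ k = 1"
    and M1: "M1 \<in> nonneg_on (\<lambda>_. UNIV)" "\<And>k. fst (margins M1) $ k = 1"
  obtains D e where "D \<in> T" "0 < e" "e \<le> 1" "margins M0 \<in> cayley_cone D"
    "margins ((1 - e) *\<^sub>R M0 + e *\<^sub>R M1) \<in> cayley_cone D"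
proof -
  obtain r where r: "0 < r" "\<And>D x. D \<in> T \<Longrightarrow> x \<in> cayley_cone D \<Longrightarrow> dist (margins M0) x < r \<Longrightarrow>
      margins M0 \<in> cayley_cone D"
    using nearby_cones by metis
  define \<gamma> where "\<gamma> e = margins ((1 - e) *\<^sub>R M0 + e *\<^sub>R M1)" for e
  have "(\<gamma> \<longlongrightarrow> \<gamma> 0) (at_right 0)"
    unfolding \<gamma>_def margins_linear_simps by (intro tendsto_intros)
  hence "\<forall>\<^sub>F e in at_right 0. dist (\<gamma> e) (\<gamma> 0) < r"
    using r(1) by (rule tendstoD)
  moreover have "\<forall>\<^sub>F e in at_right (0::real). 0 < e \<and> e \<le> 1"
    by (auto simp: eventually_at_right_field intro: exI[of _ 1])
  ultimately have "\<forall>\<^sub>F e in at_right 0. dist (\<gamma> e) (\<gamma> 0) < r \<and> 0 < e \<and> e \<le> 1"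
    by (rule eventually_conj)
  from eventually_happens'[OF trivial_limit_at_right_real this]
  obtain e where e: "dist (\<gamma> e) (\<gamma> 0) < r" "0 < e" "e \<le> 1" by auto
  define M where "M = (1 - e) *\<^sub>R M0 + e *\<^sub>R M1"
  have "M \<in> nonneg_on (\<lambda>_. UNIV)"
    unfolding M_def using e by (intro nonneg_on_add nonneg_on_scale M0 M1) auto
  moreover have "fst (margins M) $ k = 1" for k
    by (simp add: M_def margins_linear_simps M0 M1)
  ultimately obtain D N where D: "D \<in> T" "N \<in> nonneg_on D" "margins N = margins M"
    using unit_cover by meson
  hence "\<gamma> e \<in> cayley_cone D" using cayley_coneI[of N D] by (simp add: \<gamma>_def M_def)
  moreover have "\<gamma> 0 = margins M0" by (simp add: \<gamma>_def)
  ultimately show thesis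
    using that[OF D(1) e(2,3)] r(2)[OF D(1), of "\<gamma> e"] e(1) by (simp add: \<gamma>_def dist_commute)
qed

text \<open>The star of a cell covers a neighbourhood of its relative interior. Subtracting from the
  direction a combination supported on the cell itself moves the question into the slice in which
  all row sums are 1, where it is part of the hypothesis.\<close>

lemma local_cover:
  assumes E: "E \<in> T" and Z: "Z \<in> nonneg_on E" "\<And>k j. j \<in> E k \<Longrightarrow> 0 < Z $ k $ j"
    and Q: "Q \<in> nonneg_on (\<lambda>_. UNIV)"
  obtains D \<eta> where "D \<in> T" "E \<le> D" "0 < \<eta>" "\<eta> \<le> 1" "margins (Z + \<eta> *\<^sub>R (Q - Z)) \<in> cayley_cone D"
proof -
  have pos: "0 < fst (margins Z) $ k" for k
  proof -
    obtain j where "j \<in> E k" using nonempty[OF E, of k] by blast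
    thus ?thesis using fst_margins_pos[OF Z(1)] Z(2) by blast
  qed
  define u where "u = normalise_rows Z"
  have u: "u \<in> nonneg_on E" "\<And>k. fst (margins u) $ k = 1" "\<And>k j. j \<in> E k \<Longrightarrow> 0 < u $ k $ j"
    unfolding u_def
    by (rule normalise_rows_nonneg[OF Z(1)], rule normalise_rows_margins[OF pos],
        rule normalise_rows_pos[OF pos Z(2)])
  define R where "R k = fst (margins (Q - Z)) $ k" for k
  \<comment> \<open>Removing multiples of \<open>u\<close> row by row leaves a direction with zero
    row sums, so a step along it from \<open>u\<close> stays in the slice.\<close>
  define W where "W = (\<chi> k j. (Q - Z) $ k $ j - R k * u $ k $ j)"
  have rowW: "fst (margins W) $ k = 0" for k
  proof -
    have "fst (margins W) $ k = R k - R k * fst (margins u) $ k"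
      unfolding fst_margins R_def W_def by (simp add: sum_subtractf sum_distrib_left)
    thus ?thesis by (simp add: u)
  qed
  have out: "Z $ k $ j = 0" "u $ k $ j = 0" "W $ k $ j = Q $ k $ j" if "j \<notin> E k" for k j
    using nonneg_onD(3)[OF Z(1) that] nonneg_onD(3)[OF u(1) that] by (auto simp: W_def)
  obtain e0 where e0: "0 < e0" "e0 \<le> 1" "\<And>k j. 0 \<le> (u + e0 *\<^sub>R W) $ k $ j"
    by (rule perturb_nonneg[of E u W]) (use u(3) out nonneg_onD(1)[OF Q] in auto)
  obtain D e where D: "D \<in> T" "0 < e" "e \<le> 1" "margins u \<in> cayley_cone D"
    "margins ((1 - e) *\<^sub>R u + e *\<^sub>R (u + e0 *\<^sub>R W)) \<in> cayley_cone D"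
  proof (rule unit_local_cover[of u "u + e0 *\<^sub>R W"])
    show "u \<in> nonneg_on (\<lambda>_. UNIV)" using u(1) by (rule nonneg_on_top)
    show "u + e0 *\<^sub>R W \<in> nonneg_on (\<lambda>_. UNIV)" using e0(3) by (simp add: nonneg_on_def)
    show "fst (margins u) $ k = 1" for k by (rule u)
    show "fst (margins (u + e0 *\<^sub>R W)) $ k = 1" for k by (simp add: margins_linear_simps u rowW)
  qed
  obtain u' where "u' \<in> nonneg_on D" "margins u = margins u'"
    using D(4) by (auto simp: cayley_cone_def)
  hence "u \<in> nonneg_on D" by (intro unit_compat[OF E D(1) u(1) _ u(2)])
  hence ED: "E \<le> D" using full_support_le u(3) by blast
  define a where "a = e * e0"
  have a: "a > 0" using D e0 by (simp add: a_def)
  have "(1 - e) *\<^sub>R u + e *\<^sub>R (u + e0 *\<^sub>R W) = u + a *\<^sub>R W"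
    by (simp add: a_def algebra_simps)
  then obtain N where N: "N \<in> nonneg_on D" "margins N = margins (u + a *\<^sub>R W)"
    using D(5) by (auto simp: cayley_cone_def)
  \<comment> \<open>The coefficient is chosen so that \<open>W'\<close> and \<open>1 / a\<close>
    times \<open>u + a *\<^sub>R W\<close> add up to \<open>Q - Z\<close>. As \<open>W'\<close> is
    supported on \<open>E\<close>, a small multiple is absorbed by \<open>Z\<close>.\<close>
  define W' where "W' = (\<chi> k j. (R k - 1 / a) * u $ k $ j)"
  obtain \<eta> where \<eta>: "0 < \<eta>" "\<eta> \<le> 1" "\<And>k j. 0 \<le> (Z + \<eta> *\<^sub>R W') $ k $ j"
    by (rule perturb_nonneg[of E Z W']) (use Z(2) out in \<open>auto simp: W'_def\<close>)
  have "Z + \<eta> *\<^sub>R W' \<in> nonneg_on E"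
    by (rule nonneg_onI[OF \<eta>(3)]) (simp add: W'_def out)
  hence "Z + \<eta> *\<^sub>R W' + (\<eta> / a) *\<^sub>R N \<in> nonneg_on D"
    using \<eta>(1) a N(1) by (intro nonneg_on_add[OF nonneg_on_mono[OF _ ED]] nonneg_on_scale) auto
  moreover have "margins (Z + \<eta> *\<^sub>R W' + (\<eta> / a) *\<^sub>R N) = margins (Z + \<eta> *\<^sub>R (Q - Z))"
  proof -
    have "margins (Z + \<eta> *\<^sub>R W' + (\<eta> / a) *\<^sub>R N) = margins (Z + \<eta> *\<^sub>R W' + (\<eta> / a) *\<^sub>R (u + a *\<^sub>R W))"
      unfolding linear_add[OF linear_margins, of "Z + \<eta> *\<^sub>R W'"] linear_scale[OF linear_margins, of "\<eta> / a"] N(2) ..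
    also have "Z + \<eta> *\<^sub>R W' + (\<eta> / a) *\<^sub>R (u + a *\<^sub>R W) = Z + \<eta> *\<^sub>R (Q - Z)"
      using a by (simp add: vec_eq_iff W_def W'_def field_simps)
    finally show ?thesis .
  qed
  ultimately show thesis using that[OF D(1) ED \<eta>(1,2)] cayley_coneI by metis
qed

text \<open>Walk along a straight line from the slice with row sums 1, inside the relatively open cone of
  \<open>E\<close>, and consider the first point that lies in a cone not containing \<open>E\<close>. By the local covering
  property the star of the carrier of that point already contains earlier points of the line.\<close>

lemma positive_compat:
  assumes T: "A \<in> T" "C \<in> T" and M: "M \<in> nonneg_on A" and N: "N \<in> nonneg_on C"
    and eq: "margins M = margins N" and pos: "\<And>k. 0 < fst (margins M) $ k"
  shows "M \<in> nonneg_on C"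
proof -
  obtain E M' where E: "E \<in> T" "E \<le> A" "M' \<in> nonneg_on E" "\<And>k j. j \<in> E k \<Longrightarrow> 0 < M' $ k $ j"
    "margins M' = margins M" "M \<in> nonneg_on E"
    using carrier[OF T(1) M pos] by metis
  have pos': "\<And>k. 0 < fst (margins M') $ k" using pos E(5) by simp
  define u where "u = normalise_rows M'"
  have u: "u \<in> nonneg_on E" "\<And>k. fst (margins u) $ k = 1" "\<And>k j. j \<in> E k \<Longrightarrow> 0 < u $ k $ j"
    unfolding u_def
    by (rule normalise_rows_nonneg[OF E(3)], rule normalise_rows_margins[OF pos'],
        rule normalise_rows_pos[OF pos' E(4)])
  define q where "q s = (1 - s) *\<^sub>R u + s *\<^sub>R M'" for s
  define B where "B = {D\<in>T. \<not> E \<le> D}"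
  have "E \<le> C"
  proof (rule ccontr)
    assume "\<not> E \<le> C"
    \<comment> \<open>The parameters at which the line from \<open>u\<close> to \<open>M'\<close>
      meets a cone whose type does not contain \<open>E\<close>; the end point does, in the cone of
      \<open>C\<close>.\<close>
    define S where "S = {0..1} \<inter> (\<lambda>s. margins (q s)) -` (\<Union>D\<in>B. cayley_cone D)"
    have "finite B" using finite_types by (simp add: B_def)
    hence "closed (\<Union>D\<in>B. cayley_cone D)" by (intro closed_UN) (auto simp: closed_cayley_cone)
    moreover have "continuous_on {0..1} (\<lambda>s. margins (q s))"
      unfolding q_def margins_linear_simps by (intro continuous_intros)
    ultimately have "compact S"
      unfolding S_def by (intro compact_eq_bounded_closed[THEN iffD2] conjI bounded_Int
          continuous_closed_preimage) (auto simp: bounded_closed_interval)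
    moreover have "1 \<in> S"
      using \<open>\<not> E \<le> C\<close> T(2) cayley_coneI[OF N] by (auto simp: S_def q_def B_def E(5) eq)
    ultimately obtain s where s: "s \<in> S" "\<And>t. t \<in> S \<Longrightarrow> s \<le> t"
      using compact_attains_inf[of S] by blast
    have s01: "0 \<le> s" "s \<le> 1" using s(1) by (auto simp: S_def)
    obtain D where D: "D \<in> T" "\<not> E \<le> D" "margins (q s) \<in> cayley_cone D"
      using s(1) by (auto simp: S_def B_def)
    obtain N1 where N1: "N1 \<in> nonneg_on D" "margins N1 = margins (q s)"
      using D(3) by (auto simp: cayley_cone_def)
    have qE: "q s \<in> nonneg_on E"
      unfolding q_def using s01 by (intro nonneg_on_add nonneg_on_scale u E(3)) auto
    have qpos: "0 < q s $ k $ j" if "j \<in> E k" for k j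
    proof (cases "s = 1")
      case False
      thus ?thesis unfolding q_def using s01 u(3)[OF that] E(4)[OF that]
        by (auto intro!: add_pos_nonneg)
    qed (simp add: q_def E(4)[OF that])
    have "s \<noteq> 0"
    proof
      assume "s = 0"
      hence "u \<in> nonneg_on D"
        using N1 by (intro unit_compat[OF E(1) D(1) u(1) N1(1) u(2)]) (simp add: q_def)
      thus False using full_support_le[of u D E] u(3) D(2) by blast
    qed
    have "0 < fst (margins N1) $ k" for k
    proof -
      obtain j where "j \<in> E k" using nonempty[OF E(1), of k] by blast
      thus ?thesis unfolding N1(2) using fst_margins_pos[OF qE] qpos by blast
    qed
    then obtain E' N' where E': "E' \<in> T" "E' \<le> D" "N' \<in> nonneg_on E'"
      "\<And>k j. j \<in> E' k \<Longrightarrow> 0 < N' $ k $ j" "margins N' = margins N1"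
      using carrier[OF D(1) N1(1)] by metis
    \<comment> \<open>Look back from the first bad point towards \<open>u\<close>: the star of its
      carrier \<open>E'\<close> contains an earlier point of the line, where every cone has a type
      containing \<open>E\<close>.\<close>
    obtain D' \<eta> where D': "D' \<in> T" "E' \<le> D'" "0 < \<eta>" "\<eta> \<le> 1"
      "margins (N' + \<eta> *\<^sub>R (u - N')) \<in> cayley_cone D'"
      using local_cover[OF E'(1,3,4) nonneg_on_top[OF u(1)]] by metis
    have "margins (N' + \<eta> *\<^sub>R (u - N')) = margins (q ((1 - \<eta>) * s))"
      unfolding margins_linear_simps E'(5) N1(2) q_def by (simp add: algebra_simps)
    moreover have lt: "(1 - \<eta>) * s < s" using s01 \<open>s \<noteq> 0\<close> D'(3) by (simp add: algebra_simps)
    moreover have "0 \<le> (1 - \<eta>) * s" using s01 D'(4) by simp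
    ultimately have "(1 - \<eta>) * s \<in> S" if "\<not> E \<le> D'"
      using that D'(1,5) s01 by (auto simp: S_def B_def)
    hence "E \<le> D'" using s(2)[of "(1 - \<eta>) * s"] lt by (meson not_le)
    hence "q s \<in> nonneg_on E'"
      using face_support[OF E'(1) D'(1,2) nonneg_on_mono[OF qE] E'(3)] E'(5) N1(2) by simp
    hence "E \<le> E'" using full_support_le qpos by blast
    thus False using E'(2) D(2) by (meson order_trans)
  qed
  thus ?thesis using E(6) by (rule nonneg_on_mono[rotated])
qed

text \<open>Walk from the normalised matrix, which is covered, straight to \<open>M\<close>. At a
  last covered point before the end, \<open>local_cover\<close> around its carrier would still cover
  a later point.\<close>

lemma positive_cover:
  assumes M: "M \<in> nonneg_on (\<lambda>_. UNIV)" and pos: "\<And>k. 0 < fst (margins M) $ k"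
  shows "\<exists>D\<in>T. margins M \<in> cayley_cone D"
proof -
  define u where "u = normalise_rows M"
  have u: "u \<in> nonneg_on (\<lambda>_. UNIV)" "\<And>k. fst (margins u) $ k = 1"
    unfolding u_def by (rule normalise_rows_nonneg[OF M], rule normalise_rows_margins[OF pos])
  define q where "q s = (1 - s) *\<^sub>R u + s *\<^sub>R M" for s
  define S where "S = {0..1} \<inter> (\<lambda>s. margins (q s)) -` (\<Union>D\<in>T. cayley_cone D)"
  have "closed (\<Union>D\<in>T. cayley_cone D)"
    using finite_types by (intro closed_UN) (auto simp: closed_cayley_cone)
  moreover have "continuous_on {0..1} (\<lambda>s. margins (q s))"
    unfolding q_def margins_linear_simps by (intro continuous_intros)
  ultimately have "compact S"
    unfolding S_def by (intro compact_eq_bounded_closed[THEN iffD2] conjI bounded_Int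
        continuous_closed_preimage) (auto simp: bounded_closed_interval)
  moreover have "0 \<in> S"
  proof -
    obtain E N where "E \<in> T" "N \<in> nonneg_on E" "margins N = margins u"
      using unit_cover[OF u] by blast
    thus ?thesis using cayley_coneI[of N E] by (auto simp: S_def q_def)
  qed
  ultimately obtain s where s: "s \<in> S" "\<And>t. t \<in> S \<Longrightarrow> t \<le> s"
    using compact_attains_sup[of S] by blast
  have s01: "0 \<le> s" "s \<le> 1" using s(1) by (auto simp: S_def)
  obtain D where D: "D \<in> T" "margins (q s) \<in> cayley_cone D"
    using s(1) by (auto simp: S_def)
  have "s = 1"
  proof (rule ccontr)
    assume "s \<noteq> 1"
    obtain N1 where N1: "N1 \<in> nonneg_on D" "margins N1 = margins (q s)"
      using D(2) by (auto simp: cayley_cone_def)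
    have "0 < fst (margins N1) $ k" for k
      unfolding N1(2) q_def margins_linear_simps using s01 \<open>s \<noteq> 1\<close> pos[of k] u(2)[of k]
      by (simp add: add_pos_nonneg)
    then obtain E' N' where E': "E' \<in> T" "E' \<le> D" "N' \<in> nonneg_on E'"
      "\<And>k j. j \<in> E' k \<Longrightarrow> 0 < N' $ k $ j" "margins N' = margins N1"
      using carrier[OF D(1) N1(1)] by metis
    obtain D' \<eta> where D': "D' \<in> T" "E' \<le> D'" "0 < \<eta>" "\<eta> \<le> 1"
      "margins (N' + \<eta> *\<^sub>R (M - N')) \<in> cayley_cone D'"
      using local_cover[OF E'(1,3,4) M] by metis
    have "margins (N' + \<eta> *\<^sub>R (M - N')) = margins (q (s + \<eta> * (1 - s)))"
      unfolding margins_linear_simps E'(5) N1(2) q_def by (simp add: algebra_simps)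
    moreover have gt: "s + \<eta> * (1 - s) > s" using s01 \<open>s \<noteq> 1\<close> D'(3) by simp
    moreover have "s + \<eta> * (1 - s) \<le> 1"
      using mult_right_mono[OF D'(4), of "1 - s"] s01 by simp
    ultimately have "s + \<eta> * (1 - s) \<in> S" using D'(1,5) s01 by (auto simp: S_def)
    thus False using s(2) gt by fastforce
  qed
  thus ?thesis using D by (auto simp: q_def)
qed

text \<open>Some row sums of \<open>X\<close> may vanish here, so that the cells of \<open>A\<close> and \<open>C\<close> need not even meet.
  Pushing \<open>margins X\<close> a little in the directions between the barycentres of \<open>A\<close> and \<open>C\<close> makes the row
  sums positive; support in a cone is passed along the resulting segment by connectedness.\<close>

lemma compat:
  assumes T: "A \<in> T" "C \<in> T" and X: "X \<in> nonneg_on A" and Z: "Z \<in> nonneg_on C"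
    and eq: "margins X = margins Z"
  shows "X \<in> nonneg_on C"
proof (rule ccontr)
  assume XC: "X \<notin> nonneg_on C"
  define P where "P = margins X"
  note uA = uniform_on_props[of A, OF nonempty[OF T(1)]]
  note uC = uniform_on_props[of C, OF nonempty[OF T(2)]]
  define Y where "Y s = (1 - s) *\<^sub>R uniform_on A + s *\<^sub>R uniform_on C" for s
  define y where "y s = margins (Y s)" for s
  have yc: "continuous_on {0..1} y"
    unfolding y_def Y_def margins_linear_simps by (intro continuous_intros)
  obtain e where e: "0 < e" "\<And>D x. D \<in> T \<Longrightarrow> x \<in> cayley_cone D \<Longrightarrow> dist P x < e \<Longrightarrow> P \<in> cayley_cone D"
    using nearby_cones by metis
  have "bounded (y ` {0..1})" by (intro compact_imp_bounded compact_continuous_image yc) simp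
  then obtain b where b: "b > 0" "\<And>s. s \<in> {0..1} \<Longrightarrow> norm (y s) \<le> b"
    by (auto simp: bounded_pos)
  \<comment> \<open>With this factor the shift \<open>\<eta> *\<^sub>R y s\<close> has norm at most
    \<open>e / 2\<close>, so every cone containing a shifted point contains
    \<open>P\<close>.\<close>
  define \<eta> where "\<eta> = e / (2 * b)"
  have \<eta>: "\<eta> > 0" using e(1) b(1) by (simp add: \<eta>_def)
  have near: "P \<in> cayley_cone D" if "D \<in> T" "s \<in> {0..1}" "P + \<eta> *\<^sub>R y s \<in> cayley_cone D" for D s
  proof (rule e(2)[OF that(1,3)])
    have "dist P (P + \<eta> *\<^sub>R y s) = \<eta> * norm (y s)" using \<eta> by (simp add: dist_norm)
    also have "\<dots> \<le> \<eta> * b" using \<eta> b(2)[OF that(2)] by (intro mult_left_mono) auto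
    also have "\<dots> < e" using e(1) b(1) by (simp add: \<eta>_def)
    finally show "dist P (P + \<eta> *\<^sub>R y s) < e" .
  qed
  have YN: "Y s \<in> nonneg_on (\<lambda>_. UNIV)" and Yrow: "fst (y s) $ k = 1" if "s \<in> {0..1}" for s k
  proof -
    show "Y s \<in> nonneg_on (\<lambda>_. UNIV)" unfolding Y_def using that
      by (intro nonneg_on_add nonneg_on_scale nonneg_on_top[OF uA(1)] nonneg_on_top[OF uC(1)]) auto
    show "fst (y s) $ k = 1" unfolding y_def Y_def margins_linear_simps using uA(2) uC(2) by simp
  qed
  have P0: "0 \<le> fst P $ k" for k
    unfolding P_def fst_margins using nonneg_onD(1)[OF X] by (intro sum_nonneg) auto
  have row: "0 < fst (P + c *\<^sub>R y s) $ k" if "s \<in> {0..1}" "c > 0" for s k c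
    using P0[of k] Yrow[OF that(1), of k] that(2) by simp
  define G where "G F = {s\<in>{0..1}. P + \<eta> *\<^sub>R y s \<in> (\<Union>D\<in>F. cayley_cone D)}" for F
  have clG: "closed (G F)" if "F \<subseteq> T" for F
  proof -
    have cl: "closed (\<Union>D\<in>F. cayley_cone D)"
      using finite_subset[OF that finite_types] by (intro closed_UN) (auto simp: closed_cayley_cone)
    have ct: "continuous_on {0..1} (\<lambda>s. P + \<eta> *\<^sub>R y s)" by (intro continuous_intros yc)
    have "G F = {0..1} \<inter> (\<lambda>s. P + \<eta> *\<^sub>R y s) -` (\<Union>D\<in>F. cayley_cone D)"
      by (auto simp: G_def)
    thus ?thesis using continuous_closed_preimage[OF ct closed_atLeastAtMost cl] by (simp only:)
  qed
  \<comment> \<open>The types that support \<open>X\<close> and those that do not give two closed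
    sets covering the parameter interval. Both are nonempty, so some shifted point lies in a cone of
    each kind.\<close>
  define F1 where "F1 = {D\<in>T. X \<in> nonneg_on D}"
  define F2 where "F2 = {D\<in>T. X \<notin> nonneg_on D}"
  have cov: "{0..1} \<subseteq> G F1 \<union> G F2"
  proof
    fix s :: real assume s: "s \<in> {0..1}"
    have "X + \<eta> *\<^sub>R Y s \<in> nonneg_on (\<lambda>_. UNIV)"
      using \<eta> by (intro nonneg_on_add nonneg_on_scale nonneg_on_top[OF X] YN[OF s]) auto
    moreover have PY: "margins (X + \<eta> *\<^sub>R Y s) = P + \<eta> *\<^sub>R y s"
      by (simp add: margins_linear_simps P_def y_def)
    ultimately obtain D where "D \<in> T" "P + \<eta> *\<^sub>R y s \<in> cayley_cone D"
      using positive_cover row[OF s \<eta>] by metis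
    thus "s \<in> G F1 \<union> G F2" using s by (auto simp: G_def F1_def F2_def)
  qed
  have "X + \<eta> *\<^sub>R Y 0 \<in> nonneg_on A"
    using \<eta> by (intro nonneg_on_add nonneg_on_scale X) (auto simp: Y_def uA)
  hence "P + \<eta> *\<^sub>R y 0 \<in> cayley_cone A"
    using cayley_coneI by (fastforce simp: margins_linear_simps P_def y_def)
  hence 0: "0 \<in> G F1" using T(1) X by (auto simp: G_def F1_def)
  have "Z + \<eta> *\<^sub>R Y 1 \<in> nonneg_on C"
    using \<eta> by (intro nonneg_on_add nonneg_on_scale Z) (auto simp: Y_def uC)
  hence "P + \<eta> *\<^sub>R y 1 \<in> cayley_cone C"
    using cayley_coneI by (fastforce simp: margins_linear_simps P_def y_def eq)
  hence 1: "1 \<in> G F2" using T(2) XC by (auto simp: G_def F2_def)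
  have sub: "F1 \<subseteq> T" "F2 \<subseteq> T" by (auto simp: F1_def F2_def)
  have "G F1 \<inter> G F2 \<inter> {0..1} \<noteq> {}"
  proof
    assume "G F1 \<inter> G F2 \<inter> {0..1} = {}"
    hence "G F1 \<inter> {0..1} = {} \<or> G F2 \<inter> {0..1} = {}"
      using connected_closedD[OF connected_Icc _ cov] clG sub by simp
    thus False using 0 1 by auto
  qed
  then obtain s D D' where s: "s \<in> {0..1}" and D: "D \<in> T" "X \<in> nonneg_on D" "P + \<eta> *\<^sub>R y s \<in> cayley_cone D"
    and D': "D' \<in> T" "X \<notin> nonneg_on D'" "P + \<eta> *\<^sub>R y s \<in> cayley_cone D'"
    by (auto simp: G_def F1_def F2_def)
  \<comment> \<open>The segment from \<open>P\<close> to the shifted point lies in both cones by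
    convexity. Away from \<open>P\<close> its row sums are positive, so
    \<open>positive_compat\<close> puts it in the cone of \<open>F\<close>; closedness adds
    \<open>P\<close>, and \<open>face_support\<close> within \<open>D\<close> then confines
    \<open>X\<close> to \<open>F\<close>.\<close>
  define F where "F k = D k \<inter> D' k" for k
  have inF: "\<exists>N \<in> nonneg_on F. margins N = P + (t * \<eta>) *\<^sub>R y s" if t: "0 < t" "t \<le> 1" for t
  proof -
    have conv: "P + (t * \<eta>) *\<^sub>R y s = (1 - t) *\<^sub>R P + t *\<^sub>R (P + \<eta> *\<^sub>R y s)"
      by (simp add: algebra_simps)
    have "P + (t * \<eta>) *\<^sub>R y s \<in> cayley_cone D" "P + (t * \<eta>) *\<^sub>R y s \<in> cayley_cone D'"
      unfolding conv using t near[OF D(1) s D(3)] near[OF D'(1) s D'(3)] D(3) D'(3)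
      by (auto intro!: convexD[OF convex_cayley_cone])
    then obtain N N' where N: "N \<in> nonneg_on D" "margins N = P + (t * \<eta>) *\<^sub>R y s"
      "N' \<in> nonneg_on D'" "margins N' = P + (t * \<eta>) *\<^sub>R y s"
      by (elim cayley_coneE)
    have "N \<in> nonneg_on D'"
      using row[OF s, of "t * \<eta>"] t \<eta> by (intro positive_compat[OF D(1) D'(1) N(1,3)]) (simp_all add: N(2,4))
    hence "N \<in> nonneg_on F" unfolding F_def using nonneg_on_Int[OF N(1)] by simp
    thus ?thesis using N(2) by blast
  qed
  obtain N where N: "N \<in> nonneg_on F" "margins N = P + \<eta> *\<^sub>R y s" using inF[of 1] by auto
  have "F k \<noteq> {}" for k
  proof
    assume "F k = {}"
    hence "fst (margins N) $ k = 0"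
      unfolding fst_margins using nonneg_onD(3)[OF N(1)] by (intro sum.neutral) auto
    thus False using row[OF s \<eta>, of k] N(2) by simp
  qed
  hence FT: "F \<in> T" using inter[OF D(1) D'(1)] unfolding F_def by (metis (no_types))
  have "P \<in> cayley_cone F"
  proof (rule closed_sequentially[OF closed_cayley_cone])
    show "P + (inverse (real (Suc n)) * \<eta>) *\<^sub>R y s \<in> cayley_cone F" for n
      using inF[of "inverse (real (Suc n))"] cayley_coneI by (fastforce simp: field_simps)
    have "(\<lambda>n. P + (inverse (real (Suc n)) * \<eta>) *\<^sub>R y s) \<longlonglongrightarrow> P + (0 * \<eta>) *\<^sub>R y s"
      by (intro tendsto_intros LIMSEQ_inverse_real_of_nat)
    thus "(\<lambda>n. P + (inverse (real (Suc n)) * \<eta>) *\<^sub>R y s) \<longlonglongrightarrow> P" by simp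
  qed
  then obtain N0 where "N0 \<in> nonneg_on F" "margins X = margins N0"
    by (auto simp: cayley_cone_def P_def)
  moreover have "F \<le> D" "F \<le> D'" by (auto simp: F_def le_fun_def)
  ultimately have "X \<in> nonneg_on D'" using face_support[OF FT D(1) _ D(2)] nonneg_on_mono by blast
  thus False using D'(2) by simp
qed

end

subsection \<open>Separating potentials\<close>

definition unit_matrix :: "'n::finite \<Rightarrow> 'd::finite \<Rightarrow> real^'d^'n" where
  "unit_matrix k j = axis k (axis j 1)"

lemma unit_matrix_nth: "unit_matrix k j $ k' $ j' = (if k' = k \<and> j' = j then 1 else 0)"
  by (simp add: unit_matrix_def axis_def)

lemma margins_unit_matrix: "margins (unit_matrix k j) = (axis k 1, axis j 1)"
proof -
  have "(\<Sum>j'\<in>UNIV. unit_matrix k j $ k' $ j') = (if k' = k then 1 else 0)" for k'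
    by (auto simp: unit_matrix_nth sum.delta')
  moreover have "(\<Sum>k'\<in>UNIV. unit_matrix k j $ k' $ j') = (if j' = j then 1 else 0)" for j'
    by (auto simp: unit_matrix_nth sum.delta')
  ultimately show ?thesis by (simp add: margins_def vec_eq_iff axis_def)
qed

lemma unit_matrix_nonneg_on: "unit_matrix k j \<in> nonneg_on D \<longleftrightarrow> j \<in> D k"
  by (auto simp: nonneg_on_def unit_matrix_nth)

text \<open>A linear functional separating the Cayley cones of \<open>A\<close> and \<open>C\<close>, which vanishes on a generator
  of either cone only if that generator is common to both; normalised in the row \<open>k\<^sub>0\<close>. For an
  arrangement of tropical hyperplanes, \<open>snd p\<close> is the difference of two points of types \<open>A\<close> and
  \<open>C\<close>.\<close>

definition separates ::
  "'n::finite \<Rightarrow> ('n \<Rightarrow> 'd::finite set) \<Rightarrow> ('n \<Rightarrow> 'd set) \<Rightarrow> (real^'n) \<times> (real^'d) \<Rightarrow> bool" where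
  "separates k\<^sub>0 A C p \<longleftrightarrow> fst p $ k\<^sub>0 = 0 \<and>
     (\<forall>k. \<forall>j\<in>A k. fst p $ k \<le> snd p $ j \<and> (fst p $ k = snd p $ j \<longrightarrow> j \<in> C k)) \<and>
     (\<forall>k. \<forall>j\<in>C k. snd p $ j \<le> fst p $ k \<and> (snd p $ j = fst p $ k \<longrightarrow> j \<in> A k))"

lemma separatesD:
  assumes "separates k\<^sub>0 A C p"
  shows "fst p $ k\<^sub>0 = 0"
    "j \<in> A k \<Longrightarrow> fst p $ k \<le> snd p $ j" "j \<in> A k \<Longrightarrow> fst p $ k = snd p $ j \<Longrightarrow> j \<in> C k"
    "j \<in> C k \<Longrightarrow> snd p $ j \<le> fst p $ k" "j \<in> C k \<Longrightarrow> snd p $ j = fst p $ k \<Longrightarrow> j \<in> A k"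
  using assms unfolding separates_def by blast+

text \<open>A positive combination of two inequalities is an equality only if both are, so the
  strictness conditions intersect. This will make the set of admissible potentials convex.\<close>

lemma separates_combine:
  assumes "separates k\<^sub>0 A C p" "separates k\<^sub>0 A D q" "0 < a" "0 < b"
  shows "separates k\<^sub>0 A (\<lambda>k. C k \<inter> D k) (a *\<^sub>R p + b *\<^sub>R q)"
proof -
  have le: "a * x + b * y \<le> a * x' + b * y'" if "x \<le> x'" "y \<le> y'" for x y x' y' :: real
    using that assms(3,4) by (intro add_mono mult_left_mono) auto
  have eq: "x = x' \<and> y = y'" if "x \<le> x'" "y \<le> y'" "a * x + b * y = a * x' + b * y'" for x y x' y' :: real
  proof -
    have "a * x \<le> a * x'" "b * y \<le> b * y'" using that assms(3,4) by auto
    hence "a * x = a * x'" "b * y = b * y'" using that(3) by linarith+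
    thus ?thesis using assms(3,4) by simp
  qed
  note p = separatesD(2,3)[OF assms(1)] and q = separatesD(2,3)[OF assms(2)]
    and p' = separatesD(4,5)[OF assms(1)] and q' = separatesD(4,5)[OF assms(2)]
  show ?thesis
    unfolding separates_def
  proof (intro conjI allI ballI impI)
    show "fst (a *\<^sub>R p + b *\<^sub>R q) $ k\<^sub>0 = 0"
      using separatesD(1)[OF assms(1)] separatesD(1)[OF assms(2)] by simp
  next
    fix k j assume j: "j \<in> A k"
    show "fst (a *\<^sub>R p + b *\<^sub>R q) $ k \<le> snd (a *\<^sub>R p + b *\<^sub>R q) $ j"
      using le[OF p(1)[OF j] q(1)[OF j]] by simp
    assume "fst (a *\<^sub>R p + b *\<^sub>R q) $ k = snd (a *\<^sub>R p + b *\<^sub>R q) $ j"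
    thus "j \<in> C k \<inter> D k" using eq[OF p(1)[OF j] q(1)[OF j]] p(2)[OF j] q(2)[OF j] by simp
  next
    fix k j assume j: "j \<in> C k \<inter> D k"
    hence j1: "j \<in> C k" and j2: "j \<in> D k" by auto
    show "snd (a *\<^sub>R p + b *\<^sub>R q) $ j \<le> fst (a *\<^sub>R p + b *\<^sub>R q) $ k"
      using le[OF p'(1)[OF j1] q'(1)[OF j2]] by simp
    assume "snd (a *\<^sub>R p + b *\<^sub>R q) $ j = fst (a *\<^sub>R p + b *\<^sub>R q) $ k"
    thus "j \<in> A k" using eq[OF p'(1)[OF j1] q'(1)[OF j2]] p'(2)[OF j1] by simp
  qed
qed

context type_complex begin

text \<open>Orient the edges of \<open>A\<close> from rows to columns and those of \<open>C\<close> from columns to rows. By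
  compatibility every directed cycle stays in \<open>A \<inter> C\<close>, so the number of predecessors of a vertex
  is a separating potential.\<close>

lemma separating_potential_exists:
  assumes T: "A \<in> T" "C \<in> T"
  shows "\<exists>p. separates k\<^sub>0 A C p"
proof -
  define R where "R = {(Inl k, Inr j) | k j. j \<in> A k} \<union> {(Inr j, Inl k) | k j. j \<in> C k}"
  \<comment> \<open>The sign turns the margins of an edge into a difference, so sums along a path
    telescope, with edges of \<open>A\<close> collected in \<open>X\<close> and those of
    \<open>C\<close> in \<open>Z\<close>. A closed path yields two matrices with equal margins, to
    which \<open>compat\<close> applies.\<close>
  define \<phi> :: "'n + 'd \<Rightarrow> (real^'n) \<times> (real^'d)" where
    "\<phi> x = (case x of Inl k \<Rightarrow> (axis k 1, 0) | Inr j \<Rightarrow> (0, - axis j 1))" for x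
  have \<phi>: "margins (unit_matrix k j) = \<phi> (Inl k) - \<phi> (Inr j)" for k j
    by (simp add: \<phi>_def margins_unit_matrix)
  have path: "\<exists>X\<in>nonneg_on A. \<exists>Z\<in>nonneg_on C. margins X - margins Z = \<phi> x - \<phi> y"
    if "(x, y) \<in> R\<^sup>*" for x y
    using that
  proof (induction rule: rtrancl_induct)
    case base
    have "0 \<in> nonneg_on A" "0 \<in> nonneg_on C" by (auto simp: nonneg_on_def)
    thus ?case by force
  next
    case (step y z)
    then obtain X Z where XZ: "X \<in> nonneg_on A" "Z \<in> nonneg_on C" "margins X - margins Z = \<phi> x - \<phi> y"
      by blast
    from step(2) consider k j where "y = Inl k" "z = Inr j" "j \<in> A k" | k j where "y = Inr j" "z = Inl k" "j \<in> C k"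
      by (auto simp: R_def)
    thus ?case
    proof cases
      case 1
      hence "X + unit_matrix k j \<in> nonneg_on A"
        using XZ by (intro nonneg_on_add) (auto simp: unit_matrix_nonneg_on)
      moreover have "margins (X + unit_matrix k j) - margins Z = \<phi> x - \<phi> z"
        using XZ(3) 1 by (simp add: margins_linear_simps \<phi> algebra_simps)
      ultimately show ?thesis using XZ(2) by blast
    next
      case 2
      hence "Z + unit_matrix k j \<in> nonneg_on C"
        using XZ by (intro nonneg_on_add) (auto simp: unit_matrix_nonneg_on)
      moreover have "margins X - margins (Z + unit_matrix k j) = \<phi> x - \<phi> z"
        using XZ(3) 2 by (simp add: margins_linear_simps \<phi> algebra_simps)
      ultimately show ?thesis using XZ(1) by blast
    qed
  qed
  have cycA: "j \<in> C k" if j: "j \<in> A k" and p: "(Inr j, Inl k) \<in> R\<^sup>*" for k j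
  proof -
    obtain X Z where XZ: "X \<in> nonneg_on A" "Z \<in> nonneg_on C" "margins X - margins Z = \<phi> (Inr j) - \<phi> (Inl k)"
      using path[OF p] by blast
    have "unit_matrix k j + X \<in> nonneg_on C"
    proof (rule compat[OF T _ XZ(2)])
      show "unit_matrix k j + X \<in> nonneg_on A"
        using XZ j by (intro nonneg_on_add) (auto simp: unit_matrix_nonneg_on)
      show "margins (unit_matrix k j + X) = margins Z"
        using XZ(3) by (simp add: margins_linear_simps \<phi> algebra_simps)
    qed
    hence "unit_matrix k j \<in> nonneg_on C"
      using nonneg_on_addD1[of "unit_matrix k j" X C A] XZ(1) j by (simp add: unit_matrix_nonneg_on)
    thus ?thesis by (simp add: unit_matrix_nonneg_on)
  qed
  have cycC: "j \<in> A k" if j: "j \<in> C k" and p: "(Inl k, Inr j) \<in> R\<^sup>*" for k j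
  proof -
    obtain X Z where XZ: "X \<in> nonneg_on A" "Z \<in> nonneg_on C" "margins X - margins Z = \<phi> (Inl k) - \<phi> (Inr j)"
      using path[OF p] by blast
    have "unit_matrix k j + Z \<in> nonneg_on A"
    proof (rule compat[OF T(2,1) _ XZ(1)])
      show "unit_matrix k j + Z \<in> nonneg_on C"
        using XZ j by (intro nonneg_on_add) (auto simp: unit_matrix_nonneg_on)
      show "margins (unit_matrix k j + Z) = margins X"
        using XZ(3) by (simp add: margins_linear_simps \<phi> algebra_simps)
    qed
    hence "unit_matrix k j \<in> nonneg_on A"
      using nonneg_on_addD1[of "unit_matrix k j" Z A C] XZ(2) j by (simp add: unit_matrix_nonneg_on)
    thus ?thesis by (simp add: unit_matrix_nonneg_on)
  qed
  \<comment> \<open>Predecessor sets grow along edges. Equal cardinalities make them equal, so the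
    edge then lies on a directed cycle and \<open>cycA\<close> or \<open>cycC\<close>
    applies.\<close>
  define f where "f x = real (card {y. (y, x) \<in> R\<^sup>*})" for x
  have f_mono: "f x \<le> f y" and f_eq: "f x = f y \<Longrightarrow> (y, x) \<in> R\<^sup>*" if "(x, y) \<in> R" for x y
  proof -
    have sub: "{z. (z, x) \<in> R\<^sup>*} \<subseteq> {z. (z, y) \<in> R\<^sup>*}" using that by (auto intro: rtrancl_into_rtrancl)
    show "f x \<le> f y" unfolding f_def using card_mono[OF _ sub] by simp
    show "(y, x) \<in> R\<^sup>*" if "f x = f y"
      using card_subset_eq[OF _ sub] that by (auto simp: f_def)
  qed
  define p :: "(real^'n) \<times> (real^'d)" where
    "p = ((\<chi> k. f (Inl k) - f (Inl k\<^sub>0)), (\<chi> j. f (Inr j) - f (Inl k\<^sub>0)))"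
  have RA: "(Inl k, Inr j) \<in> R" if "j \<in> A k" for k j using that by (auto simp: R_def)
  have RC: "(Inr j, Inl k) \<in> R" if "j \<in> C k" for k j using that by (auto simp: R_def)
  have "separates k\<^sub>0 A C p"
    unfolding separates_def p_def
    using f_mono[OF RA] f_eq[OF RA] cycA f_mono[OF RC] f_eq[OF RC] cycC by auto
  thus ?thesis by blast
qed

end

subsection \<open>Elimination\<close>

text \<open>Weights supported on the \<open>e\<close>-neighbourhoods of the covering sets give a
  continuous choice in the hulls of the labels \<open>a i\<close>. A Brouwer fixed point of the
  projected step along \<open>h\<close> satisfies the inequality, and compactness lets
  \<open>e\<close> tend to 0.\<close>

lemma variational_inequality_closed_cover:
  fixes S :: "'a::euclidean_space set" and C :: "'i \<Rightarrow> 'a set"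
    and a :: "'i \<Rightarrow> 'b::euclidean_space" and h :: "'b \<Rightarrow> 'a"
  assumes S: "compact S" "convex S" "S \<noteq> {}"
    and I: "finite I" "\<And>i. i \<in> I \<Longrightarrow> closed (C i)" "\<And>i. i \<in> I \<Longrightarrow> C i \<noteq> {}" "S \<subseteq> (\<Union>i\<in>I. C i)"
    and h: "continuous_on UNIV h"
  obtains x z where "x \<in> S" "z \<in> convex hull (a ` {i\<in>I. x \<in> C i})"
    "\<And>y. y \<in> S \<Longrightarrow> h z \<bullet> (y - x) \<le> 0"
proof -
  have approx: "\<exists>x z. x \<in> S \<and> z \<in> convex hull (a ` {i\<in>I. infdist x (C i) < e}) \<and>
      (\<forall>y\<in>S. h z \<bullet> (y - x) \<le> 0)" if "e > 0" for e :: real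
  proof -
    define \<rho> where "\<rho> i x = max 0 (e - infdist x (C i))" for i x
    define s where "s x = (\<Sum>i\<in>I. \<rho> i x)" for x
    define z where "z x = (\<Sum>i\<in>I. (\<rho> i x / s x) *\<^sub>R a i)" for x
    have rho0: "\<rho> i x \<ge> 0" for i x by (simp add: \<rho>_def)
    have spos: "s x > 0" if x: "x \<in> S" for x
    proof -
      obtain i where i: "i \<in> I" "x \<in> C i" using I x by blast
      have "infdist x (C i) = 0" using i by simp
      hence "\<rho> i x > 0" using \<open>e > 0\<close> by (simp add: \<rho>_def)
      thus ?thesis unfolding s_def using i I rho0 by (intro sum_pos2[of I i]) auto
    qed
    have zc: "continuous_on S z"
      unfolding z_def s_def \<rho>_def
      using spos unfolding s_def \<rho>_def
      by (intro continuous_intros) (auto simp: less_imp_neq[symmetric])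
    have fc: "continuous_on S (\<lambda>x. closest_point S (x + h (z x)))"
    proof -
      have 1: "continuous_on S (\<lambda>x. x + h (z x))"
        by (intro continuous_intros continuous_on_compose2[OF h zc]) auto
      have 2: "continuous_on UNIV (closest_point S)"
        using S by (intro continuous_on_closest_point) (auto simp: compact_imp_closed)
      show ?thesis
        by (rule continuous_on_compose2[OF 2 1]) simp
    qed
    have "(\<lambda>x. closest_point S (x + h (z x))) \<in> S \<rightarrow> S"
      using S by (auto intro: closest_point_in_set compact_imp_closed)
    then obtain x where x: "x \<in> S" "closest_point S (x + h (z x)) = x"
      using brouwer[OF S fc] by blast
    have vi: "h (z x) \<bullet> (y - x) \<le> 0" if "y \<in> S" for y
      using closest_point_dot[OF S(2) compact_imp_closed[OF S(1)] that, of "x + h (z x)"] x by simp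
    define J where "J = {i\<in>I. infdist x (C i) < e}"
    have zJ: "z x = (\<Sum>i\<in>J. (\<rho> i x / s x) *\<^sub>R a i)"
      unfolding z_def J_def using I by (intro sum.mono_neutral_right) (auto simp: \<rho>_def)
    have "s x = (\<Sum>i\<in>J. \<rho> i x)"
      unfolding s_def J_def using I by (intro sum.mono_neutral_right) (auto simp: \<rho>_def)
    hence "(\<Sum>i\<in>J. \<rho> i x / s x) = 1"
      using spos[OF x(1)] by (simp flip: sum_divide_distrib)
    hence "z x \<in> convex hull (a ` J)"
      unfolding zJ using I rho0 spos[OF x(1)]
      by (intro convex_sum) (auto simp: J_def hull_inc intro!: divide_nonneg_pos)
    thus ?thesis using x vi unfolding J_def by blast
  qed
  define Q where "Q m p \<longleftrightarrow> fst p \<in> S \<and>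
      snd p \<in> convex hull (a ` {i\<in>I. infdist (fst p) (C i) < inverse (real (Suc m))}) \<and>
      (\<forall>y\<in>S. h (snd p) \<bullet> (y - fst p) \<le> 0)" for m :: nat and p
  have "\<exists>p. Q m p" for m
    using approx[of "inverse (real (Suc m))"] by (auto simp: Q_def)
  then obtain p where p: "\<And>m. Q m (p m)" by metis
  note p = p[unfolded Q_def, THEN conjunct1] p[unfolded Q_def, THEN conjunct2, THEN conjunct1]
    p[unfolded Q_def, THEN conjunct2, THEN conjunct2, THEN bspec]
  have "compact (S \<times> (convex hull (a ` I)))"
    using I by (intro compact_Times S compact_convex_hull finite_imp_compact) auto
  moreover have "p m \<in> S \<times> (convex hull (a ` I))" for m
    using p(1)[of m] p(2)[of m]
      hull_mono[of "a ` {i\<in>I. infdist (fst (p m)) (C i) < inverse (Suc m)}" "a ` I" convex]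
    by (auto simp: mem_Times_iff)
  ultimately obtain q r where q: "q \<in> S \<times> (convex hull (a ` I))" "strict_mono (r :: nat \<Rightarrow> nat)"
      "(p \<circ> r) \<longlonglongrightarrow> q"
    unfolding compact_def by metis
  define x z where "x = fst q" and "z = snd q"
  have fx: "(\<lambda>m. fst (p (r m))) \<longlonglongrightarrow> x" and sz: "(\<lambda>m. snd (p (r m))) \<longlonglongrightarrow> z"
    using tendsto_fst[OF q(3)] tendsto_snd[OF q(3)] by (simp_all add: x_def z_def o_def)
  have inv: "(\<lambda>m. inverse (real (Suc (r m)))) \<longlonglongrightarrow> 0"
    using LIMSEQ_subseq_LIMSEQ[OF LIMSEQ_inverse_real_of_nat q(2)] by (simp add: o_def)
  define J where "J = {i\<in>I. x \<in> C i}"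
  \<comment> \<open>A closed set missing the limit \<open>x\<close> has positive distance from it,
    so its label eventually drops out of the hulls.\<close>
  have "\<forall>\<^sub>F m in sequentially. \<forall>i\<in>I - J. infdist (fst (p (r m))) (C i) > inverse (real (Suc (r m)))"
  proof (subst eventually_ball_finite_distrib)
    show "finite (I - J)" using I by auto
    show "\<forall>i\<in>I - J. \<forall>\<^sub>F m in sequentially. inverse (real (Suc (r m))) < infdist (fst (p (r m))) (C i)"
    proof
      fix i assume i: "i \<in> I - J"
      hence "infdist x (C i) > 0"
        using I(2,3)[of i] infdist_pos_not_in_closed[of "C i" x] by (auto simp: J_def)
      have "(\<lambda>m. infdist (fst (p (r m))) (C i) - inverse (real (Suc (r m)))) \<longlonglongrightarrow> infdist x (C i) - 0"
        by (intro tendsto_intros fx inv)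
      from order_tendstoD(1)[OF this, of 0] \<open>infdist x (C i) > 0\<close>
      show "\<forall>\<^sub>F m in sequentially. inverse (real (Suc (r m))) < infdist (fst (p (r m))) (C i)" by simp
    qed
  qed
  hence "\<forall>\<^sub>F m in sequentially. snd (p (r m)) \<in> convex hull (a ` J)"
  proof eventually_elim
    case (elim m)
    hence "{i\<in>I. infdist (fst (p (r m))) (C i) < inverse (Suc (r m))} \<subseteq> J" by force
    thus ?case by (rule subsetD[OF hull_mono[OF image_mono] p(2)])
  qed
  moreover have "closed (convex hull (a ` J))"
    using I by (intro compact_imp_closed compact_convex_hull finite_imp_compact) (auto simp: J_def)
  ultimately have zJ: "z \<in> convex hull (a ` J)"
    using sz Lim_in_closed_set[of "convex hull (a ` J)" "\<lambda>m. snd (p (r m))" sequentially z] by simp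
  have "h z \<bullet> (y - x) \<le> 0" if "y \<in> S" for y
  proof -
    have "isCont h z" using h by (simp add: continuous_on_eq_continuous_at)
    hence "(\<lambda>m. h (snd (p (r m)))) \<longlonglongrightarrow> h z" using sz by (rule isCont_tendsto_compose)
    hence "(\<lambda>m. h (snd (p (r m))) \<bullet> (y - fst (p (r m)))) \<longlonglongrightarrow> h z \<bullet> (y - x)"
      by (intro tendsto_intros fx)
    thus ?thesis by (rule LIMSEQ_le_const2) (use p(3)[OF that] in auto)
  qed
  thus thesis using that zJ q(1) by (auto simp: J_def x_def mem_Times_iff)
qed

context type_complex begin

text \<open>By \<open>unit_compat\<close> both cones share a representing matrix. Its row sums are
  1, so no component of the intersection of the types is empty.\<close>

lemma unit_cone_inter:
  assumes C: "C \<in> T" "margins M \<in> cayley_cone C" and D: "D \<in> T" "margins M \<in> cayley_cone D"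
    and row: "\<And>k. fst (margins M) $ k = 1"
  shows "(\<lambda>k. C k \<inter> D k) \<in> T" "margins M \<in> cayley_cone (\<lambda>k. C k \<inter> D k)"
proof -
  obtain N N' where N: "N \<in> nonneg_on C" "margins N = margins M" "N' \<in> nonneg_on D" "margins N' = margins M"
    using C(2) D(2) by (elim cayley_coneE)
  have "N \<in> nonneg_on D" by (rule unit_compat[OF C(1) D(1) N(1,3)]) (simp_all add: N row)
  hence N_in: "N \<in> nonneg_on (\<lambda>k. C k \<inter> D k)" by (rule nonneg_on_Int[OF N(1)])
  thus "margins M \<in> cayley_cone (\<lambda>k. C k \<inter> D k)" using cayley_coneI[OF N_in] N(2) by simp
  show "(\<lambda>k. C k \<inter> D k) \<in> T"
  proof (rule inter[OF C(1) D(1)])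
    fix k show "C k \<inter> D k \<noteq> {}"
    proof
      assume "C k \<inter> D k = {}"
      hence "fst (margins N) $ k = 0"
        unfolding fst_margins using nonneg_onD(3)[OF N_in] by (intro sum.neutral) auto
      thus False using row[of k] N(2) by simp
    qed
  qed
qed

text \<open>The variational inequality yields a row-stochastic matrix \<open>x\<close> and potentials separating a
  cell \<open>C\<close> through the margins of \<open>x\<close> from \<open>A\<close> and from \<open>B\<close>. With \<open>w\<close> and \<open>u\<close> the maxima of the column
  and row potentials (the tropical line segment between \<open>A\<close> and \<open>B\<close>), double counting forces \<open>w\<close> to equal
  \<open>u\<close> on the dominating rows of \<open>A\<close> and \<open>B\<close>, and the face of \<open>C\<close> on which \<open>w\<close> is maximal is the
  desired type.\<close>

theorem elimination:
  assumes AB: "A \<in> T" "B \<in> T"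
  shows "\<exists>C\<in>T. C k\<^sub>0 = A k\<^sub>0 \<union> B k\<^sub>0 \<and> (\<forall>k. C k \<in> {A k, B k, A k \<union> B k})"
proof -
  have "\<exists>p. \<forall>D\<in>T. separates k\<^sub>0 A' D (p D)" if "A' \<in> T" for A'
    by (intro bchoice ballI separating_potential_exists[OF that])
  then obtain pA pB where p: "\<And>D. D \<in> T \<Longrightarrow> separates k\<^sub>0 A D (pA D)" "\<And>D. D \<in> T \<Longrightarrow> separates k\<^sub>0 B D (pB D)"
    using AB by meson
  define a where "a D = (pA D, pB D)" for D
  define S where "S = row_stochastic_on (\<lambda>k. A k \<union> B k)"
  \<comment> \<open>The payoff of column \<open>j\<close> in row \<open>k\<close>: the largest
    column potential among those of \<open>A\<close> and \<open>B\<close> whose type has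
    \<open>j\<close> in row \<open>k\<close>. The default 0 occurs only at positions where matrices
    in \<open>S\<close> vanish.\<close>
  define g :: "((real^'n) \<times> (real^'d)) \<times> ((real^'n) \<times> (real^'d)) \<Rightarrow> 'n \<Rightarrow> 'd \<Rightarrow> real" where
    "g z k j = (if j \<in> A k then if j \<in> B k then max (snd (fst z) $ j) (snd (snd z) $ j) else snd (fst z) $ j
      else if j \<in> B k then snd (snd z) $ j else 0)" for z k j
  define h :: "((real^'n) \<times> (real^'d)) \<times> ((real^'n) \<times> (real^'d)) \<Rightarrow> real^'d^'n" where "h z = (\<chi> k j. g z k j)" for z
  have "continuous_on UNIV (\<lambda>z. g z k j)" for k j
    unfolding g_def by (cases "j \<in> A k"; cases "j \<in> B k") (auto intro!: continuous_intros)
  hence hc: "continuous_on UNIV h" unfolding h_def by (intro continuous_on_vec_lambda)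
  have ne: "A k \<union> B k \<noteq> {}" for k using nonempty[OF AB(1)] by auto
  have cl: "closed {M. margins M \<in> cayley_cone D}" for D :: "'n \<Rightarrow> 'd set"
    using continuous_closed_preimage[OF continuous_on_margins[of UNIV] closed_UNIV closed_cayley_cone[of D]]
    by (simp add: vimage_def)
  obtain x z where x: "x \<in> S" and z: "z \<in> convex hull (a ` {D\<in>T. x \<in> {M. margins M \<in> cayley_cone D}})"
    and vi: "\<And>y. y \<in> S \<Longrightarrow> h z \<bullet> (y - x) \<le> 0"
  proof (rule variational_inequality_closed_cover[of S T "\<lambda>D. {M. margins M \<in> cayley_cone D}" h a])
    show "compact S" "convex S" by (simp_all add: S_def compact_row_stochastic_on convex_row_stochastic_on)
    show "S \<noteq> {}" using uniform_on_props[of "\<lambda>k. A k \<union> B k", OF ne] by (auto simp: S_def row_stochastic_on_def)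
    show "finite T" by (rule finite_types)
    show "closed {M. margins M \<in> cayley_cone D}" for D :: "'n \<Rightarrow> 'd set" by (rule cl)
    show "{M. margins M \<in> cayley_cone D} \<noteq> {}" if "D \<in> T" for D
      using uniform_on_props(1)[of D, OF nonempty[OF that]] cayley_coneI by blast
    show "S \<subseteq> (\<Union>D\<in>T. {M. margins M \<in> cayley_cone D})"
    proof
      fix M assume "M \<in> S"
      hence "\<exists>E\<in>T. \<exists>N\<in>nonneg_on E. margins N = margins M \<and> (\<forall>k. \<forall>j\<in>E k. 0 < N $ k $ j)"
        by (intro unit_cover) (auto simp: S_def row_stochastic_on_def intro: nonneg_on_top)
      then obtain E N where "E \<in> T" "N \<in> nonneg_on E" "margins N = margins M" by blast
      thus "M \<in> (\<Union>D\<in>T. {M. margins M \<in> cayley_cone D})" using cayley_coneI[of N E] by auto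
    qed
    show "continuous_on UNIV h" by (rule hc)
  qed (rule that)
  have xN: "x \<in> nonneg_on (\<lambda>k. A k \<union> B k)" and xrow: "\<And>k. fst (margins x) $ k = 1"
    using x by (auto simp: S_def row_stochastic_on_def)
  \<comment> \<open>The labels averaged in \<open>z\<close> may belong to different cells through
    \<open>margins x\<close>. Combining potentials intersects these cells, so \<open>H\<close> is
    convex and a single cell \<open>C\<close> serves for \<open>z\<close>.\<close>
  define H where "H = {z. \<exists>C\<in>T. margins x \<in> cayley_cone C \<and> separates k\<^sub>0 A C (fst z) \<and> separates k\<^sub>0 B C (snd z)}"
  have "convex H"
    unfolding convex_alt
  proof (intro ballI allI impI)
    fix y y' and t :: real assume y: "y \<in> H" "y' \<in> H" and t: "0 \<le> t \<and> t \<le> 1"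
    obtain C where C: "C \<in> T" "margins x \<in> cayley_cone C" "separates k\<^sub>0 A C (fst y)" "separates k\<^sub>0 B C (snd y)"
      using y(1) by (auto simp: H_def)
    obtain D where D: "D \<in> T" "margins x \<in> cayley_cone D" "separates k\<^sub>0 A D (fst y')" "separates k\<^sub>0 B D (snd y')"
      using y(2) by (auto simp: H_def)
    consider "t = 0" | "t = 1" | "0 < 1 - t" "0 < t" using t by fastforce
    thus "(1 - t) *\<^sub>R y + t *\<^sub>R y' \<in> H"
    proof cases
      case 3
      have "separates k\<^sub>0 A (\<lambda>k. C k \<inter> D k) (fst ((1 - t) *\<^sub>R y + t *\<^sub>R y'))"
        "separates k\<^sub>0 B (\<lambda>k. C k \<inter> D k) (snd ((1 - t) *\<^sub>R y + t *\<^sub>R y'))"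
        using separates_combine[OF C(3) D(3) 3] separates_combine[OF C(4) D(4) 3] by simp_all
      thus ?thesis using unit_cone_inter[OF C(1,2) D(1,2) xrow] unfolding H_def by blast
    qed (use y in auto)
  qed
  moreover have "a ` {D\<in>T. x \<in> {M. margins M \<in> cayley_cone D}} \<subseteq> H"
    using p by (auto simp: a_def H_def)
  ultimately have "z \<in> H" using z hull_minimal by blast
  then obtain C where C: "C \<in> T" "margins x \<in> cayley_cone C" "separates k\<^sub>0 A C (fst z)" "separates k\<^sub>0 B C (snd z)"
    by (auto simp: H_def)
  obtain Z where Z: "Z \<in> nonneg_on C" "margins Z = margins x" using C(2) by (elim cayley_coneE)
  define uA where "uA k = fst (fst z) $ k" for k
  define uB where "uB k = fst (snd z) $ k" for k
  define vA where "vA j = snd (fst z) $ j" for j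
  define vB where "vB j = snd (snd z) $ j" for j
  define u where "u k = max (uA k) (uB k)" for k
  define w where "w j = max (vA j) (vB j)" for j
  have A: "uA k \<le> vA j" "uA k = vA j \<Longrightarrow> j \<in> C k" if "j \<in> A k" for k j
    using separatesD(2,3)[OF C(3) that] by (simp_all add: uA_def vA_def)
  have B: "uB k \<le> vB j" "uB k = vB j \<Longrightarrow> j \<in> C k" if "j \<in> B k" for k j
    using separatesD(2,3)[OF C(4) that] by (simp_all add: uB_def vB_def)
  have CA: "vA j \<le> uA k" "vA j = uA k \<Longrightarrow> j \<in> A k" if "j \<in> C k" for k j
    using separatesD(4,5)[OF C(3) that] by (simp_all add: uA_def vA_def)
  have CB: "vB j \<le> uB k" "vB j = uB k \<Longrightarrow> j \<in> B k" if "j \<in> C k" for k j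
    using separatesD(4,5)[OF C(4) that] by (simp_all add: uB_def vB_def)
  have k0: "uA k\<^sub>0 = uB k\<^sub>0"
    using separatesD(1)[OF C(3)] separatesD(1)[OF C(4)] by (simp add: uA_def uB_def)
  have gA: "vA j \<le> g z k j" if "j \<in> A k" for k j using that by (simp add: g_def vA_def)
  have gB: "vB j \<le> g z k j" if "j \<in> B k" for k j using that by (simp add: g_def vB_def)
  have gw: "g z k j \<le> w j" if "j \<in> A k \<union> B k" for k j using that by (auto simp: g_def w_def vA_def vB_def)
  define m where "m k = (\<Sum>l\<in>UNIV. g z k l * x $ k $ l)" for k
  have gm: "g z k j \<le> m k" if j: "j \<in> A k \<union> B k" for k j
  proof -
    \<comment> \<open>Replacing row \<open>k\<close> of \<open>x\<close> by a vertex stays in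
      \<open>S\<close>, so the variational inequality bounds each payoff in the row by the mean
      payoff \<open>m k\<close>.\<close>
    define y where "y = (\<chi> k'. if k' = k then axis j 1 else x $ k')"
    have yn: "y $ k' $ l = (if k' = k then if l = j then 1 else 0 else x $ k' $ l)" for k' l
      by (simp add: y_def axis_def)
    have "y \<in> nonneg_on (\<lambda>k. A k \<union> B k)"
    proof (rule nonneg_onI)
      show "0 \<le> y $ k' $ l" for k' l using nonneg_onD(1)[OF xN] by (simp add: yn)
      show "y $ k' $ l = 0" if "l \<notin> A k' \<union> B k'" for k' l
        using nonneg_onD(3)[OF xN that] that j by (auto simp: yn)
    qed
    moreover have "fst (margins y) $ k' = 1" for k'
      using xrow[of k'] unfolding fst_margins by (cases "k' = k") (simp_all add: yn)
    ultimately have "y \<in> S" by (simp add: S_def row_stochastic_on_def)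
    have "h z \<bullet> (y - x) = (\<Sum>k'\<in>UNIV. \<Sum>l\<in>UNIV. g z k' l * (y $ k' $ l - x $ k' $ l))"
      by (simp add: inner_vec_def h_def)
    also have "\<dots> = (\<Sum>k'\<in>UNIV. if k' = k then g z k j - m k else 0)"
    proof (rule sum.cong[OF refl])
      fix k'
      show "(\<Sum>l\<in>UNIV. g z k' l * (y $ k' $ l - x $ k' $ l)) = (if k' = k then g z k j - m k else 0)"
        by (simp add: yn m_def right_diff_distrib sum_subtractf if_distrib[of "\<lambda>t. g z k _ * t"] cong: if_cong)
    qed
    also have "\<dots> = g z k j - m k" by simp
    finally show ?thesis using vi[OF \<open>y \<in> S\<close>] by simp
  qed
  have um: "u k \<le> m k" for k
  proof -
    obtain i j where "i \<in> A k" "j \<in> B k" using nonempty[OF AB(1), of k] nonempty[OF AB(2), of k] by blast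
    thus ?thesis using A(1)[of i k] gA[of i k] gm[of i k] B(1)[of j k] gB[of j k] gm[of j k]
      by (auto simp: u_def)
  qed
  have cols: "(\<Sum>k\<in>UNIV. x $ k $ l) = (\<Sum>k\<in>UNIV. Z $ k $ l)" for l
    using Z(2) by (metis snd_margins)
  have wu: "w j \<le> u k" if "j \<in> C k" for k j using CA(1)[OF that] CB(1)[OF that] by (auto simp: w_def u_def)
  \<comment> \<open>The double count: payoffs are at most \<open>w\<close> on the support of
    \<open>x\<close>, the column sums of \<open>x\<close> and \<open>Z\<close> agree, and
    \<open>w\<close> is at most \<open>u\<close> on the support of \<open>Z\<close>. Together with
    \<open>um\<close> this forces \<open>m = u\<close>.\<close>
  have "(\<Sum>k\<in>UNIV. m k) \<le> (\<Sum>k\<in>UNIV. \<Sum>l\<in>UNIV. w l * x $ k $ l)"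
    unfolding m_def
  proof (intro sum_mono)
    fix k l show "g z k l * x $ k $ l \<le> w l * x $ k $ l"
      using gw[of l k] nonneg_onD(1)[OF xN, of k l] nonneg_onD(3)[OF xN, of l k]
      by (cases "l \<in> A k \<union> B k") (auto intro: mult_right_mono)
  qed
  also have "\<dots> = (\<Sum>l\<in>UNIV. w l * (\<Sum>k\<in>UNIV. Z $ k $ l))"
    by (subst sum.swap) (simp add: sum_distrib_left[symmetric] cols)
  also have "\<dots> = (\<Sum>k\<in>UNIV. \<Sum>l\<in>UNIV. w l * Z $ k $ l)"
    by (subst sum.swap) (simp add: sum_distrib_left)
  also have "\<dots> \<le> (\<Sum>k\<in>UNIV. \<Sum>l\<in>UNIV. u k * Z $ k $ l)"
  proof (intro sum_mono)
    fix k l show "w l * Z $ k $ l \<le> u k * Z $ k $ l"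
      using wu[of l k] nonneg_onD(1)[OF Z(1), of k l] nonneg_onD(3)[OF Z(1), of l k]
      by (cases "l \<in> C k") (auto intro: mult_right_mono)
  qed
  also have "\<dots> = (\<Sum>k\<in>UNIV. u k)"
  proof (rule sum.cong[OF refl])
    fix k show "(\<Sum>l\<in>UNIV. u k * Z $ k $ l) = u k"
      using xrow[of k] Z(2) by (simp add: sum_distrib_left[symmetric] fst_margins[symmetric])
  qed
  finally have "(\<Sum>k\<in>UNIV. m k) \<le> (\<Sum>k\<in>UNIV. u k)" .
  hence "(\<Sum>k\<in>UNIV. m k) = (\<Sum>k\<in>UNIV. u k)" using sum_mono[of UNIV u m] um by simp
  hence mu: "m k = u k" for k
    using sum_mono_inv[of u UNIV m k] um by simp
  define F where "F k = {j \<in> C k. \<forall>l\<in>C k. w l \<le> w j}" for k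
  have FT: "F \<in> T" unfolding F_def by (rule argmax_face[OF C(1)])
  \<comment> \<open>Here \<open>u k = uA k \<le> vA j \<le> g z k j \<le> m k = u k\<close>, so
    equality holds throughout and strict separation puts \<open>j\<close> in
    \<open>C k\<close>.\<close>
  have inA: "j \<in> C k \<and> w j = u k" if "j \<in> A k" "uA k = u k" for k j
  proof -
    have "uA k = vA j" using A(1)[OF that(1)] gA[OF that(1)] gm[of j k] mu[of k] that by simp
    hence "j \<in> C k" using A(2)[OF that(1)] by simp
    moreover have "u k \<le> w j" using \<open>uA k = vA j\<close> that(2) by (simp add: w_def)
    ultimately show ?thesis using wu[of j k] by simp
  qed
  have inB: "j \<in> C k \<and> w j = u k" if "j \<in> B k" "uB k = u k" for k j
  proof -
    have "uB k = vB j" using B(1)[OF that(1)] gB[OF that(1)] gm[of j k] mu[of k] that by simp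
    hence "j \<in> C k" using B(2)[OF that(1)] by simp
    moreover have "u k \<le> w j" using \<open>uB k = vB j\<close> that(2) by (simp add: w_def)
    ultimately show ?thesis using wu[of j k] by simp
  qed
  have ex: "\<exists>j\<in>C k. w j = u k" for k
  proof -
    obtain i j where "i \<in> A k" "j \<in> B k" using nonempty[OF AB(1), of k] nonempty[OF AB(2), of k] by blast
    moreover have "uA k = u k \<or> uB k = u k" by (auto simp: u_def max_def)
    ultimately show ?thesis using inA[of i k] inB[of j k] by blast
  qed
  have F_eq: "F k = {j \<in> C k. w j = u k}" for k
    using wu[of _ k] ex[of k] unfolding F_def by fastforce
  have F: "F k = {j. j \<in> A k \<and> uA k = u k \<or> j \<in> B k \<and> uB k = u k}" for k
  proof
    show "F k \<subseteq> {j. j \<in> A k \<and> uA k = u k \<or> j \<in> B k \<and> uB k = u k}"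
    proof
      fix j assume "j \<in> F k"
      hence j: "j \<in> C k" "w j = u k" by (auto simp: F_eq)
      have "uA k \<le> u k" "uB k \<le> u k" by (auto simp: u_def)
      moreover have "vA j = w j \<or> vB j = w j" by (auto simp: w_def max_def)
      ultimately show "j \<in> {j. j \<in> A k \<and> uA k = u k \<or> j \<in> B k \<and> uB k = u k}"
        using CA[OF j(1)] CB[OF j(1)] j(2) by auto
    qed
    show "{j. j \<in> A k \<and> uA k = u k \<or> j \<in> B k \<and> uB k = u k} \<subseteq> F k"
      using inA inB by (auto simp: F_eq)
  qed
  \<comment> \<open>Both row potentials are normalised to 0 in this row, so both attain the maximum
    and both sets contribute.\<close>
  have "F k\<^sub>0 = A k\<^sub>0 \<union> B k\<^sub>0" unfolding F using k0 by (auto simp: u_def)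
  moreover have "F k \<in> {A k, B k, A k \<union> B k}" for k
  proof -
    have "uA k = u k \<or> uB k = u k" by (simp add: u_def max_def)
    moreover have "F k = (if uA k = u k then A k else {}) \<union> (if uB k = u k then B k else {})"
      unfolding F by auto
    ultimately show ?thesis by (cases "uA k = u k"; cases "uB k = u k"; simp)
  qed
  ultimately show ?thesis using FT by blast
qed

end

subsection \<open>Types of the cells of a mixed subdivision\<close>

lemma coord_simplex_eq:
  "coord_simplex J = {x. (\<forall>j. 0 \<le> x $ j) \<and> (\<forall>j. j \<notin> J \<longrightarrow> x $ j = 0) \<and> (\<Sum>j\<in>UNIV. x $ j) = 1}"
  (is "_ = ?R")
proof
  have "convex ?R"
    by (auto simp: convex_def sum.distrib simp flip: sum_distrib_left)
  moreover have "(\<lambda>j. axis j 1) ` J \<subseteq> ?R" by (auto simp: axis_def)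
  ultimately show "coord_simplex J \<subseteq> ?R" unfolding coord_simplex_def by (intro hull_minimal)
  show "?R \<subseteq> coord_simplex J"
  proof
    fix x assume "x \<in> ?R"
    hence x: "\<And>j. 0 \<le> x $ j" "\<And>j. j \<notin> J \<Longrightarrow> x $ j = 0" "(\<Sum>j\<in>UNIV. x $ j) = 1" by auto
    have "x = (\<Sum>j\<in>J. (x $ j) *\<^sub>R axis j 1)"
      using x(2) by (auto simp: vec_eq_iff axis_def if_distrib[of "\<lambda>t. _ * t"] cong: if_cong)
    moreover have "(\<Sum>j\<in>J. (x $ j) *\<^sub>R axis j 1) \<in> coord_simplex J"
      unfolding coord_simplex_def
    proof (rule convex_sum)
      show "(\<Sum>j\<in>J. x $ j) = 1" using x(2,3) sum.mono_neutral_left[of UNIV J "($) x"] by auto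
    qed (use x in \<open>auto intro: hull_inc\<close>)
    ultimately show "x \<in> coord_simplex J" by simp
  qed
qed

lemma coord_simplex_Int: "coord_simplex J \<inter> coord_simplex J' = coord_simplex (J \<inter> J')"
  by (auto simp: coord_simplex_eq)

lemma row_stochastic_on_iff: "M \<in> row_stochastic_on D \<longleftrightarrow> (\<forall>k. M $ k \<in> coord_simplex (D k))"
  by (auto simp: row_stochastic_on_def nonneg_on_def fst_margins coord_simplex_eq)

text \<open>The rows of a row-stochastic matrix are one point from each summand, and its column sums
  are the coordinates of their sum.\<close>

lemma minkowski_cell_eq:
  fixes D :: "'n::finite \<Rightarrow> 'd::finite set"
  shows "minkowski_cell D = (\<lambda>M. snd (margins M)) ` row_stochastic_on D"
proof -
  have sm: "snd (margins M) = (\<Sum>k\<in>UNIV. M $ k)" for M :: "real^'d^'n"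
    by (simp add: margins_def vec_eq_iff)
  have "minkowski_cell D = {sum s UNIV | s. \<forall>k. s k \<in> coord_simplex (D k)}"
    by (simp add: minkowski_cell_def set_sum_alt)
  also have "\<dots> = (\<lambda>M. snd (margins M)) ` row_stochastic_on D"
  proof (intro set_eqI iffI)
    fix x assume "x \<in> {sum s UNIV | s. \<forall>k. s k \<in> coord_simplex (D k)}"
    then obtain s where s: "x = sum s UNIV" "\<forall>k. s k \<in> coord_simplex (D k)" by blast
    have "x = snd (margins (\<chi> k. s k))" using s(1) by (simp add: sm)
    moreover have "(\<chi> k. s k) \<in> row_stochastic_on D" using s(2) by (simp add: row_stochastic_on_iff)
    ultimately show "x \<in> (\<lambda>M. snd (margins M)) ` row_stochastic_on D" by blast
  next
    fix x assume "x \<in> (\<lambda>M. snd (margins M)) ` row_stochastic_on D"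
    thus "x \<in> {sum s UNIV | s. \<forall>k. s k \<in> coord_simplex (D k)}"
      by (auto simp: row_stochastic_on_iff sm)
  qed
  finally show ?thesis .
qed

section \<open>Recovering types from cells and faces\<close>

lemma uniform_on_row_stochastic: "(\<And>k. D k \<noteq> {}) \<Longrightarrow> uniform_on D \<in> row_stochastic_on D"
  using uniform_on_props[of D] by (simp add: row_stochastic_on_def)

lemma row_stochastic_on_mono: "M \<in> row_stochastic_on D \<Longrightarrow> D \<le> D' \<Longrightarrow> M \<in> row_stochastic_on D'"
  by (auto simp: row_stochastic_on_def intro: nonneg_on_mono)

text \<open>The \<open>l\<close>-th coordinate attains the maximum \<open>card {k. l \<in> D k}\<close> on the cell of \<open>D\<close>, so the
  cell determines that number.\<close>

lemma minkowski_cell_cancel: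
  fixes D E :: "'n::finite \<Rightarrow> 'd::finite set"
  assumes ED: "E \<le> D" and ne: "\<And>k. D k \<noteq> {}" and sub: "minkowski_cell D \<subseteq> minkowski_cell E"
  shows "E = D"
proof (rule ccontr)
  assume "E \<noteq> D"
  then obtain k l where kl: "l \<in> D k" "l \<notin> E k" using ED by (fastforce simp: le_fun_def fun_eq_iff)
  \<comment> \<open>Column \<open>l\<close> is used in every row where \<open>D\<close> permits it;
    in the other rows any column of \<open>D\<close> will do.\<close>
  define M :: "real^'d^'n" where "M = (\<chi> i. axis (if l \<in> D i then l else SOME j. j \<in> D i) 1)"
  have "(SOME j. j \<in> D i) \<in> D i" for i using ne[of i] some_in_eq by blast
  hence "M \<in> row_stochastic_on D"
    by (auto simp: row_stochastic_on_iff coord_simplex_def M_def intro!: hull_inc)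
  hence "snd (margins M) \<in> minkowski_cell E" using sub by (auto simp: minkowski_cell_eq)
  then obtain N where N: "N \<in> row_stochastic_on E" "snd (margins M) = snd (margins N)"
    by (auto simp: minkowski_cell_eq)
  have N01: "N $ i $ l \<le> 1" for i
  proof -
    have "N $ i $ l \<le> fst (margins N) $ i"
      unfolding fst_margins using N(1) by (intro member_le_sum) (auto simp: row_stochastic_on_def nonneg_on_def)
    thus ?thesis using N(1) by (simp add: row_stochastic_on_def)
  qed
  have le: "N $ i $ l \<le> M $ i $ l" for i
  proof (cases "l \<in> D i")
    case True thus ?thesis using N01 by (simp add: M_def axis_def)
  next
    case False
    hence "l \<notin> E i" using ED by (auto simp: le_fun_def)
    hence "N $ i $ l = 0" using N(1) by (auto simp: row_stochastic_on_def intro: nonneg_onD(3))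
    thus ?thesis by (simp add: M_def axis_def)
  qed
  have "N $ k $ l = 0" using N(1) kl(2) by (auto simp: row_stochastic_on_def intro: nonneg_onD(3))
  hence "N $ k $ l < M $ k $ l" using kl(1) by (simp add: M_def axis_def)
  hence "snd (margins N) $ l < snd (margins M) $ l"
    unfolding snd_margins using le by (intro sum_strict_mono_ex1) auto
  thus False using N(2) by simp
qed

text \<open>The type of the face on which the functional with coefficients \<open>w\<close> is
  maximal.\<close>

definition argmax_type :: "('d \<Rightarrow> real) \<Rightarrow> ('n \<Rightarrow> 'd set) \<Rightarrow> 'n \<Rightarrow> 'd set" where
  "argmax_type w D k = {j \<in> D k. \<forall>l\<in>D k. w l \<le> w j}"

lemma argmax_type_le: "argmax_type w D \<le> D"
  by (auto simp: argmax_type_def le_fun_def)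

lemma argmax_type_nonempty:
  fixes D :: "'n \<Rightarrow> 'd::finite set"
  assumes "D k \<noteq> {}"
  shows "argmax_type w D k \<noteq> {}"
proof -
  have "Max (w ` D k) \<in> w ` D k" using assms by (intro Max_in) auto
  then obtain j where j: "j \<in> D k" "Max (w ` D k) = w j" by blast
  have "w l \<le> w j" if "l \<in> D k" for l using that j(2)[symmetric] by simp
  thus ?thesis using j(1) by (auto simp: argmax_type_def)
qed

text \<open>The bound is the sum of the maxima of \<open>a\<close> on the sets \<open>D k\<close>.
  The defect is a sum of nonnegative terms, one for each entry, and vanishes only if
  \<open>M\<close> is supported on maximising columns.\<close>

lemma inner_minkowski_cell:
  fixes a :: "real^'d::finite" and D :: "'n::finite \<Rightarrow> 'd set"
  assumes ne: "\<And>k. D k \<noteq> {}"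
  obtains b where "\<And>M. M \<in> row_stochastic_on D \<Longrightarrow> a \<bullet> snd (margins M) \<le> b"
    "\<And>M. M \<in> row_stochastic_on D \<Longrightarrow>
       a \<bullet> snd (margins M) = b \<longleftrightarrow> M \<in> row_stochastic_on (argmax_type (($) a) D)"
proof -
  define m where "m k = Max (($) a ` D k)" for k
  have mge: "a $ j \<le> m k" if "j \<in> D k" for k j using that by (simp add: m_def)
  have meq: "j \<in> argmax_type (($) a) D k \<longleftrightarrow> a $ j = m k" if "j \<in> D k" for k j
  proof
    assume "j \<in> argmax_type (($) a) D k"
    hence "m k \<le> a $ j" unfolding m_def using ne[of k] by (auto simp: argmax_type_def)
    thus "a $ j = m k" using mge[OF that] by simp
  qed (use that mge in \<open>auto simp: argmax_type_def\<close>)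
  have gap: "(\<Sum>k\<in>UNIV. m k) - a \<bullet> snd (margins M) = (\<Sum>k\<in>UNIV. \<Sum>j\<in>UNIV. (m k - a $ j) * M $ k $ j)"
    and nonneg: "\<And>k j. 0 \<le> (m k - a $ j) * M $ k $ j"
    if M: "M \<in> row_stochastic_on D" for M
  proof -
    have "a \<bullet> snd (margins M) = (\<Sum>j\<in>UNIV. \<Sum>k\<in>UNIV. a $ j * M $ k $ j)"
      by (simp add: inner_vec_def snd_margins sum_distrib_left)
    also have "\<dots> = (\<Sum>k\<in>UNIV. \<Sum>j\<in>UNIV. a $ j * M $ k $ j)" by (rule sum.swap)
    finally have 1: "a \<bullet> snd (margins M) = (\<Sum>k\<in>UNIV. \<Sum>j\<in>UNIV. a $ j * M $ k $ j)" .
    have "(\<Sum>j\<in>UNIV. m k * M $ k $ j) = m k" for k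
      using M by (simp add: row_stochastic_on_def fst_margins sum_distrib_left[symmetric])
    thus "(\<Sum>k\<in>UNIV. m k) - a \<bullet> snd (margins M) = (\<Sum>k\<in>UNIV. \<Sum>j\<in>UNIV. (m k - a $ j) * M $ k $ j)"
      by (simp add: 1 left_diff_distrib sum_subtractf)
    fix k j show "0 \<le> (m k - a $ j) * M $ k $ j"
      using M mge[of j k] nonneg_onD(1,3)[of M D] by (cases "j \<in> D k") (auto simp: row_stochastic_on_def)
  qed
  show thesis
  proof (rule that[of "\<Sum>k\<in>UNIV. m k"])
    fix M assume M: "M \<in> row_stochastic_on D"
    have "0 \<le> (\<Sum>k\<in>UNIV. m k) - a \<bullet> snd (margins M)"
      unfolding gap[OF M] by (intro sum_nonneg nonneg[OF M])
    thus "a \<bullet> snd (margins M) \<le> (\<Sum>k\<in>UNIV. m k)" by simp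
    have "a \<bullet> snd (margins M) = (\<Sum>k\<in>UNIV. m k) \<longleftrightarrow> (\<Sum>k\<in>UNIV. \<Sum>j\<in>UNIV. (m k - a $ j) * M $ k $ j) = 0"
      using gap[OF M] by linarith
    also have "\<dots> \<longleftrightarrow> (\<forall>k j. (m k - a $ j) * M $ k $ j = 0)"
      using nonneg[OF M] by (simp add: sum_nonneg_eq_0_iff sum_nonneg)
    also have "\<dots> \<longleftrightarrow> M \<in> row_stochastic_on (argmax_type (($) a) D)"
    proof
      assume *: "\<forall>k j. (m k - a $ j) * M $ k $ j = 0"
      have "j \<in> argmax_type (($) a) D k" if "M $ k $ j \<noteq> 0" for k j
      proof -
        have "j \<in> D k" using M that by (auto simp: row_stochastic_on_def dest: nonneg_onD)
        moreover have "(m k - a $ j) * M $ k $ j = 0" using * by blast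
        hence "a $ j = m k" using that by simp
        ultimately show ?thesis using meq[of j k] by blast
      qed
      thus "M \<in> row_stochastic_on (argmax_type (($) a) D)"
        using M by (auto simp: row_stochastic_on_def nonneg_on_def)
    next
      assume *: "M \<in> row_stochastic_on (argmax_type (($) a) D)"
      show "\<forall>k j. (m k - a $ j) * M $ k $ j = 0"
      proof (intro allI)
        fix k j
        show "(m k - a $ j) * M $ k $ j = 0"
        proof (cases "M $ k $ j = 0")
          case False
          hence j: "j \<in> argmax_type (($) a) D k" using * by (auto simp: row_stochastic_on_def nonneg_on_def)
          hence "j \<in> D k" by (simp add: argmax_type_def)
          thus ?thesis using meq j by simp
        qed simp
      qed
    qed
    finally show "a \<bullet> snd (margins M) = (\<Sum>k\<in>UNIV. m k) \<longleftrightarrow> M \<in> row_stochastic_on (argmax_type (($) a) D)" .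
  qed
qed

text \<open>A functional exposing the face also exposes the cell of an argmax type \<open>X\<close>
  with \<open>E \<le> X\<close>. The two cells coincide, so cancellation gives \<open>E = X\<close>,
  and every matrix of type \<open>D\<close> over the face attains the maximum.\<close>

lemma face_type_support:
  assumes poly: "polytope (minkowski_cell D)" and ne: "\<And>k. E k \<noteq> {}" and ED: "E \<le> D"
    and face: "minkowski_cell E face_of minkowski_cell D"
    and M: "M \<in> row_stochastic_on D" "snd (margins M) \<in> minkowski_cell E"
  shows "M \<in> nonneg_on E"
proof -
  have neD: "D k \<noteq> {}" for k using ne[of k] ED by (auto simp: le_fun_def)
  have "minkowski_cell E exposed_face_of minkowski_cell D"
    using exposed_face_of_polyhedron[OF polytope_imp_polyhedron[OF poly]] face by blast
  then obtain a b where ab: "minkowski_cell D \<subseteq> {x. a \<bullet> x \<le> b}"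
    "minkowski_cell E = minkowski_cell D \<inter> {x. a \<bullet> x = b}"
    unfolding exposed_face_of_def by blast
  obtain b' where b': "\<And>M. M \<in> row_stochastic_on D \<Longrightarrow> a \<bullet> snd (margins M) \<le> b'"
    "\<And>M. M \<in> row_stochastic_on D \<Longrightarrow>
       a \<bullet> snd (margins M) = b' \<longleftrightarrow> M \<in> row_stochastic_on (argmax_type (($) a) D)"
    using inner_minkowski_cell[of D a, OF neD] by metis
  define X where "X = argmax_type (($) a) D"
  have XD: "X \<le> D" unfolding X_def by (rule argmax_type_le)
  have neX: "X k \<noteq> {}" for k unfolding X_def by (rule argmax_type_nonempty) (rule neD)
  have val: "a \<bullet> snd (margins N) = b" if "N \<in> row_stochastic_on D" "snd (margins N) \<in> minkowski_cell E" for N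
    using that ab(2) by blast
  have uE: "uniform_on E \<in> row_stochastic_on D" "uniform_on E \<in> row_stochastic_on E"
    using uniform_on_row_stochastic[of E, OF ne] row_stochastic_on_mono[OF _ ED] by auto
  have uX: "uniform_on X \<in> row_stochastic_on D" "uniform_on X \<in> row_stochastic_on X"
    using uniform_on_row_stochastic[of X, OF neX] row_stochastic_on_mono[OF _ XD] by auto
  have valE: "a \<bullet> snd (margins (uniform_on E)) = b"
    using uE by (intro val) (auto simp: minkowski_cell_eq)
  have "b' = a \<bullet> snd (margins (uniform_on X))" using b'(2)[OF uX(1)] uX(2) by (simp add: X_def)
  also have "\<dots> \<le> b" using ab(1) uX(1) by (auto simp: minkowski_cell_eq)
  finally have bb: "b' = b" using b'(1)[OF uE(1)] valE by simp
  have "uniform_on E \<in> nonneg_on X"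
    using b'(2)[OF uE(1)] valE bb by (simp add: X_def row_stochastic_on_def)
  hence EX: "E \<le> X" by (rule full_support_le) (rule uniform_on_props(3)[OF ne])
  have "minkowski_cell X \<subseteq> minkowski_cell E"
  proof
    fix x assume "x \<in> minkowski_cell X"
    then obtain N where N: "x = snd (margins N)" "N \<in> row_stochastic_on X" by (auto simp: minkowski_cell_eq)
    have ND: "N \<in> row_stochastic_on D" using row_stochastic_on_mono[OF N(2) XD] .
    hence "a \<bullet> x = b" using b'(2)[OF ND] N bb by (simp add: X_def)
    thus "x \<in> minkowski_cell E" unfolding ab(2) using ND N(1) by (auto simp: minkowski_cell_eq)
  qed
  hence "E = X" using minkowski_cell_cancel[of E X, OF EX neX] by simp
  moreover have "M \<in> row_stochastic_on X" using b'(2)[OF M(1)] val[OF M] bb by (simp add: X_def)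
  ultimately show ?thesis by (simp add: row_stochastic_on_def)
qed

text \<open>The uniform matrix of either type represents a point of the common cell, so
  \<open>face_type_support\<close> places its full support inside the other type.\<close>

lemma face_type_unique:
  assumes "polytope (minkowski_cell D)" "\<And>k. E k \<noteq> {}" "\<And>k. E' k \<noteq> {}" "E \<le> D" "E' \<le> D"
    "minkowski_cell E face_of minkowski_cell D" "minkowski_cell E' = minkowski_cell E"
  shows "E' = E"
proof (rule antisym)
  have le: "F' \<le> F" if "\<And>k. F k \<noteq> {}" "\<And>k. F' k \<noteq> {}" "F \<le> D" "F' \<le> D"
    "minkowski_cell F face_of minkowski_cell D" "minkowski_cell F' = minkowski_cell F" for F F'
  proof -
    have u: "uniform_on F' \<in> row_stochastic_on F'" by (rule uniform_on_row_stochastic) (rule that(2))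
    have "snd (margins (uniform_on F')) \<in> minkowski_cell F"
      using u that(6) by (metis minkowski_cell_eq imageI)
    hence "uniform_on F' \<in> nonneg_on F"
      by (intro face_type_support[OF assms(1) that(1,3,5)] row_stochastic_on_mono[OF u that(4)])
    thus ?thesis by (rule full_support_le) (rule uniform_on_props(3)[OF that(2)])
  qed
  show "E' \<le> E" by (rule le[OF assms(2,3,4,5,6,7)])
  show "E \<le> E'" by (rule le[OF assms(3,2,5,4)]) (use assms(6,7) in simp_all)
qed

text \<open>Passes from geometry to the matrix axioms. Argmax types and componentwise intersections
  describe faces of cells; these belong to the subdivision, and uniqueness identifies their given
  types.\<close>

lemma mixed_subdivision_type_complex:
  fixes K :: "(real^'d::finite) set set" and \<tau> :: "(real^'d) set \<Rightarrow> 'n::finite \<Rightarrow> 'd set"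
  assumes "mixed_subdivision K \<tau>"
  shows "type_complex (cell_types K \<tau>)"
proof -
  note ms = assms[unfolded mixed_subdivision_def]
  note ps = ms[THEN conjunct1, unfolded polyhedral_subdivision_def]
  have fin: "finite K" using ps by (elim conjE)
  have poly: "polytope C" if "C \<in> K" for C using ps that by (elim conjE) blast
  have face: "F \<in> K" if "C \<in> K" "F face_of C" "F \<noteq> {}" for C F using ps that by (elim conjE) blast
  have Int: "C \<inter> D face_of C" if "C \<in> K" "D \<in> K" for C D using ps that by (elim conjE) blast
  have Un: "\<Union>K = (\<lambda>x. real CARD('n) *\<^sub>R x) ` coord_simplex UNIV" using ps by (elim conjE)
  have ne: "\<tau> C i \<noteq> {}" and cell: "C = minkowski_cell (\<tau> C)" if "C \<in> K" for C i
    using ms[THEN conjunct2, THEN conjunct1, rule_format, OF that] by auto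
  have IntM: "C \<inter> D = minkowski_cell (\<lambda>i. \<tau> C i \<inter> \<tau> D i)" if "C \<in> K" "D \<in> K" for C D
    using ms[THEN conjunct2, THEN conjunct2, rule_format, OF that]
    unfolding minkowski_cell_def coord_simplex_Int .
  \<comment> \<open>\<open>F\<close> is its own intersection with \<open>C\<close>, hence the cell
    of the componentwise intersection of the types; by cancellation that intersection is
    \<open>\<tau> F\<close>.\<close>
  have sub: "\<tau> F \<le> \<tau> C" if "F \<in> K" "C \<in> K" "F \<subseteq> C" for F C
  proof -
    have "minkowski_cell (\<tau> F) = minkowski_cell (\<lambda>i. \<tau> F i \<inter> \<tau> C i)"
      using IntM[OF that(1,2)] cell[OF that(1)] that(3) by (metis inf.absorb1)
    hence "(\<lambda>i. \<tau> F i \<inter> \<tau> C i) = \<tau> F"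
      by (intro minkowski_cell_cancel ne[OF that(1)]) (auto simp: le_fun_def)
    hence "\<tau> F i \<inter> \<tau> C i = \<tau> F i" for i by (rule fun_cong)
    thus ?thesis by (auto simp: le_fun_def)
  qed
  \<comment> \<open>The type that \<open>\<tau>\<close> assigns to the face lies below
    \<open>\<tau> C\<close> and describes the same face as \<open>E\<close>, so the two
    agree.\<close>
  have type: "E \<in> cell_types K \<tau>"
    if "C \<in> K" "\<And>k. E k \<noteq> {}" "E \<le> \<tau> C" "minkowski_cell E face_of C" for C E
  proof -
    have "minkowski_cell E \<noteq> {}"
      using uniform_on_row_stochastic[of E, OF that(2)] by (auto simp: minkowski_cell_eq)
    hence EK: "minkowski_cell E \<in> K" using face that by blast
    have C: "minkowski_cell (\<tau> C) = C" using cell[OF that(1)] by simp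
    have "\<tau> (minkowski_cell E) = E"
    proof (rule face_type_unique[of "\<tau> C"])
      show "polytope (minkowski_cell (\<tau> C))" using poly[OF that(1)] C by simp
      show "\<tau> (minkowski_cell E) \<le> \<tau> C"
        using sub[OF EK that(1)] face_of_imp_subset[OF that(4)] by blast
      show "minkowski_cell (\<tau> (minkowski_cell E)) = minkowski_cell E" using cell[OF EK] by simp
      show "minkowski_cell E face_of minkowski_cell (\<tau> C)" using that(4) C by simp
    qed (use that ne[OF EK] in auto)
    thus ?thesis using EK unfolding cell_types_def by (metis imageI)
  qed
  show ?thesis
  proof
    show "finite (cell_types K \<tau>)" using fin by (simp add: cell_types_def)
    show "C k \<noteq> {}" if "C \<in> cell_types K \<tau>" for C k using that ne by (auto simp: cell_types_def)
  next
    fix A :: "'n \<Rightarrow> 'd set" and w :: "'d \<Rightarrow> real"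
    assume "A \<in> cell_types K \<tau>"
    then obtain C where C: "C \<in> K" "A = \<tau> C" by (auto simp: cell_types_def)
    define a :: "real^'d" where "a = (\<chi> j. w j)"
    have aw: "($) a = w" by (auto simp: a_def)
    obtain b where b: "\<And>M. M \<in> row_stochastic_on (\<tau> C) \<Longrightarrow> a \<bullet> snd (margins M) \<le> b"
      "\<And>M. M \<in> row_stochastic_on (\<tau> C) \<Longrightarrow>
         a \<bullet> snd (margins M) = b \<longleftrightarrow> M \<in> row_stochastic_on (argmax_type (($) a) (\<tau> C))"
      using inner_minkowski_cell[of "\<tau> C" a, OF ne[OF C(1)]] by metis
    have "minkowski_cell (argmax_type w (\<tau> C)) = minkowski_cell (\<tau> C) \<inter> {x. a \<bullet> x = b}"
      using b(2) row_stochastic_on_mono[OF _ argmax_type_le[of w "\<tau> C"]]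
      unfolding minkowski_cell_eq aw by fast
    hence "minkowski_cell (argmax_type w (\<tau> C)) = C \<inter> {x. a \<bullet> x = b}" using cell[OF C(1)] by simp
    moreover have "a \<bullet> x \<le> b" if "x \<in> C" for x
    proof -
      have "x \<in> minkowski_cell (\<tau> C)" using cell[OF C(1)] that by simp
      thus ?thesis using b(1) by (auto simp: minkowski_cell_eq)
    qed
    ultimately have "minkowski_cell (argmax_type w (\<tau> C)) face_of C"
      using face_of_Int_supporting_hyperplane_le[of C a b] polytope_imp_convex[OF poly[OF C(1)]] by simp
    hence "argmax_type w (\<tau> C) \<in> cell_types K \<tau>"
      by (intro type[OF C(1)] argmax_type_nonempty ne[OF C(1)] argmax_type_le)
    thus "(\<lambda>k. {j \<in> A k. \<forall>l\<in>A k. w l \<le> w j}) \<in> cell_types K \<tau>"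
      unfolding C(2) argmax_type_def .
  next
    fix A B :: "'n \<Rightarrow> 'd set"
    assume "A \<in> cell_types K \<tau>" "B \<in> cell_types K \<tau>" and neAB: "\<And>k. A k \<inter> B k \<noteq> {}"
    then obtain C D where CD: "C \<in> K" "A = \<tau> C" "D \<in> K" "B = \<tau> D" by (auto simp: cell_types_def)
    show "(\<lambda>k. A k \<inter> B k) \<in> cell_types K \<tau>"
      using Int[OF CD(1,3)] IntM[OF CD(1,3)] neAB
      by (intro type[OF CD(1)]) (auto simp: CD(2,4) le_fun_def)
  next
    fix A B :: "'n \<Rightarrow> 'd set" and M N :: "real^'d^'n"
    assume AB: "A \<in> cell_types K \<tau>" "B \<in> cell_types K \<tau>" and M: "M \<in> nonneg_on A" and N: "N \<in> nonneg_on B"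
      and row: "\<And>k. fst (margins M) $ k = 1" and eq: "margins M = margins N"
    obtain C D where CD: "C \<in> K" "A = \<tau> C" "D \<in> K" "B = \<tau> D" using AB by (auto simp: cell_types_def)
    have MC: "M \<in> row_stochastic_on (\<tau> C)" using M row CD by (simp add: row_stochastic_on_def)
    have ND: "N \<in> row_stochastic_on (\<tau> D)" using N row CD eq by (simp add: row_stochastic_on_def)
    have "snd (margins M) \<in> C" using MC cell[OF CD(1)] by (metis minkowski_cell_eq imageI)
    moreover have "snd (margins M) \<in> D" using ND cell[OF CD(3)] eq by (metis minkowski_cell_eq imageI)
    ultimately have x: "snd (margins M) \<in> minkowski_cell (\<lambda>i. \<tau> C i \<inter> \<tau> D i)"
      using IntM[OF CD(1,3)] by blast
    then obtain P where P: "P \<in> row_stochastic_on (\<lambda>i. \<tau> C i \<inter> \<tau> D i)" by (auto simp: minkowski_cell_eq)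
    have "coord_simplex {} = ({} :: (real^'d) set)" by (simp add: coord_simplex_def)
    hence "\<tau> C i \<inter> \<tau> D i \<noteq> {}" for i using P by (metis row_stochastic_on_iff empty_iff)
    moreover have "polytope (minkowski_cell (\<tau> C))" using poly[OF CD(1)] cell[OF CD(1)] by simp
    moreover have "minkowski_cell (\<lambda>i. \<tau> C i \<inter> \<tau> D i) face_of minkowski_cell (\<tau> C)"
      using Int[OF CD(1,3)] IntM[OF CD(1,3)] cell[OF CD(1)] by simp
    ultimately have "M \<in> nonneg_on (\<lambda>i. \<tau> C i \<inter> \<tau> D i)"
      using x MC by (intro face_type_support[of "\<tau> C"]) (auto simp: le_fun_def)
    thus "M \<in> nonneg_on B" by (rule nonneg_on_mono) (auto simp: CD(4) le_fun_def)
  next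
    fix M :: "real^'d^'n"
    assume M: "M \<in> nonneg_on (\<lambda>_. UNIV)" and row: "\<And>k. fst (margins M) $ k = 1"
    define c where "c = snd (margins M)"
    have tot: "(\<Sum>j\<in>UNIV. c $ j) = real CARD('n)"
      using total_margins[of M] by (simp add: row c_def)
    have c0: "0 \<le> c $ j" for j
      unfolding c_def snd_margins using nonneg_onD(1)[OF M] by (intro sum_nonneg) auto
    have "inverse (real CARD('n)) *\<^sub>R c \<in> coord_simplex UNIV"
      using tot c0 by (simp add: coord_simplex_eq flip: sum_distrib_left)
    hence "real CARD('n) *\<^sub>R inverse (real CARD('n)) *\<^sub>R c \<in> (\<lambda>x. real CARD('n) *\<^sub>R x) ` coord_simplex UNIV"
      by (rule imageI)
    hence "c \<in> \<Union>K" unfolding Un by simp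
    hence "{E\<in>K. c \<in> E} \<noteq> {}" by blast
    \<comment> \<open>A minimal cell through \<open>c\<close> has \<open>c\<close> in its relative
      interior, since a proper face through \<open>c\<close> would be a smaller cell.\<close>
    then obtain E where E: "E \<in> K" "c \<in> E" and Emin: "\<And>F. F \<in> K \<Longrightarrow> c \<in> F \<Longrightarrow> F \<subseteq> E \<Longrightarrow> E = F"
      using finite_has_minimal[of "{E\<in>K. c \<in> E}"] fin by auto
    have polyE: "polyhedron E" using poly[OF E(1)] by (rule polytope_imp_polyhedron)
    have "c \<notin> rel_frontier E"
    proof
      assume "c \<in> rel_frontier E"
      then obtain F where F: "F face_of E" "F \<noteq> E" "c \<in> F"
        unfolding rel_frontier_of_polyhedron_alt[OF polyE] by blast
      hence "F \<in> K" using face[OF E(1)] by blast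
      thus False using Emin[of F] F face_of_imp_subset by blast
    qed
    hence ri: "c \<in> rel_interior E"
      using E(2) closure_subset[of E] by (auto simp: rel_frontier_def)
    define g where "g = uniform_on (\<tau> E)"
    note g = uniform_on_props[of "\<tau> E", OF ne[OF E(1)], folded g_def]
    have "snd (margins g) \<in> E"
      using cell[OF E(1)] uniform_on_row_stochastic[of "\<tau> E", OF ne[OF E(1)]]
      unfolding g_def by (metis minkowski_cell_eq imageI)
    \<comment> \<open>Prolonging the segment from the image of \<open>g\<close> beyond
      \<open>c\<close> inside \<open>E\<close> exhibits \<open>c\<close> as a convex combination in
      which \<open>g\<close> has the positive weight \<open>1 - 1 / e\<close>; this makes
      \<open>N\<close> positive on the whole type.\<close>
    then obtain e where e: "e > 1" "(1 - e) *\<^sub>R snd (margins g) + e *\<^sub>R c \<in> E"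
      using ri convex_rel_interior_iff[OF polyhedron_imp_convex[OF polyE], of c] E(2) by blast
    have "(1 - e) *\<^sub>R snd (margins g) + e *\<^sub>R c \<in> minkowski_cell (\<tau> E)" using e(2) cell[OF E(1)] by simp
    then obtain Q where Q: "Q \<in> row_stochastic_on (\<tau> E)" "snd (margins Q) = (1 - e) *\<^sub>R snd (margins g) + e *\<^sub>R c"
      by (auto simp: minkowski_cell_eq)
    have QN: "Q \<in> nonneg_on (\<tau> E)" "\<And>k. fst (margins Q) $ k = 1" using Q(1) by (auto simp: row_stochastic_on_def)
    define N where "N = (1 / e) *\<^sub>R Q + (1 - 1 / e) *\<^sub>R g"
    have "N \<in> nonneg_on (\<tau> E)"
      unfolding N_def using e(1) by (intro nonneg_on_add nonneg_on_scale QN(1) g(1)) auto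
    moreover have "0 < N $ k $ j" if "j \<in> \<tau> E k" for k j
      unfolding N_def using e(1) g(3)[OF that] nonneg_onD(1)[OF QN(1), of k j] by (auto intro!: add_nonneg_pos)
    moreover have "margins N = margins M"
    proof (rule prod_eqI)
      show "fst (margins N) = fst (margins M)"
        by (simp add: vec_eq_iff N_def margins_linear_simps QN(2) g(2) row)
      have "snd (margins N) = c"
        using e(1) by (simp add: N_def margins_linear_simps Q(2) vec_eq_iff field_simps)
      thus "snd (margins N) = snd (margins M)" by (simp add: c_def)
    qed
    moreover have "\<tau> E \<in> cell_types K \<tau>" using E(1) by (simp add: cell_types_def)
    ultimately show "\<exists>E\<in>cell_types K \<tau>. \<exists>N\<in>nonneg_on E. margins N = margins M \<and> (\<forall>k. \<forall>j\<in>E k. 0 < N $ k $ j)"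
      by blast
  qed
qed

theorem theorem6p9:
  fixes K :: "(real^'d::finite) set set"
    and \<tau> :: "(real^'d) set \<Rightarrow> 'n::finite \<Rightarrow> 'd set"
  assumes "mixed_subdivision K \<tau>"
  shows "elimination_property (cell_types K \<tau>)"
proof -
  interpret type_complex "cell_types K \<tau>" using assms by (rule mixed_subdivision_type_complex)
  show ?thesis unfolding elimination_property_def using elimination by blast
qed

end
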